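(* Let $\mathbf{p}=(p_j)_{j\in[m]}$ be a tuple of positive real numbers. Then for any feasible quiver datum $(\mathbf{V},\mathbf{p})$ there exists a tuple of matrices $\mathbf{G}=(G_a)_a$ (of the same shape as $\mathbf{V}$) such that $(\mathbf{G},\mathbf{p})$ is geometric and such that for every $\varepsilon>0$ there is a tuple of matrices $\mathbf{V}'$ equivalent to $\mathbf{V}$ with $\|\mathbf{G}-\mathbf{V}'\|<\varepsilon$.
   Context: Notation: $[r]=\{1,\dots,r\}$; $\mathsf{PD}_{r}$ is the set of real symmetric positive definite $r\times r$ matrices. Let $k,m$ be positive integers, $(d_1,\dots,d_k)$ and $(n_1,\dots,n_m)$ tuples of positive integers, and $\mathbf{p}=(p_1,\dots,p_m)$ a tuple of positive reals with $\sum_{i\in[k]}d_i=\sum_{j\in[m]}p_jn_j$. For each $(i,j)\in[k]\times[m]$ let $\mathbf{A}_{ij}$ be a finite index set (the sets being pairwise disjoint), and let $\mathbf{V}=(V_a\in\mathbb{R}^{n_j\times d_i}: a\in\mathbf{A}_{ij},\,i\in[k],\,j\in[m])$. The pair $(\mathbf{V},\mathbf{p})$ is called a quiver datum. Its capacity is $$\mathrm{Cap}(\mathbf{V},\mathbf{p})=\inf_{(Y_j\in\mathsf{PD}_{n_j})_{j\in[m]}}\frac{\prod_{i=1}^k\det\big(\sum_{j=1}^m p_j\sum_{a\in\mathbf{A}_{ij}}V_a^TY_jV_a\big)}{\prod_{j=1}^m(\det Y_j)^{p_j}}.$$ $(\mathbf{V},\mathbf{p})$ is feasible if $\mathrm{Cap}(\mathbf{V},\mathbf{p})>0$.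 Two tuples $\mathbf{V},\mathbf{V}'$ of the same shape are equivalent if there are invertible matrices $(M_i\in\mathbb{R}^{d_i\times d_i})_{i\in[k]}$ and $(N_j\in\mathbb{R}^{n_j\times n_j})_{j\in[m]}$ with $V_a'=N_jV_aM_i^{-1}$ for all $a\in\mathbf{A}_{ij}$, $i\in[k]$, $j\in[m]$. $(\mathbf{V},\mathbf{p})$ is geometric if $\sum_{j=1}^m p_j\sum_{a\in\mathbf{A}_{ij}}V_a^TV_a=\mathrm{id}_{\mathbb{R}^{d_i}}$ for each $i\in[k]$ and $\sum_{i=1}^k\sum_{a\in\mathbf{A}_{ij}}V_aV_a^T=\mathrm{id}_{\mathbb{R}^{n_j}}$ for each $j\in[m]$. $\|\cdot\|$ is any fixed norm on the finite-dimensional space of tuples of matrices of the given shape. *)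

theory Defs
  imports
    Complex_Main
    "HOL-Library.FuncSet"
    "HOL-Library.Disjoint_Sets"
    "Jordan_Normal_Form.Determinant"
    "Jordan_Normal_Form.Gauss_Jordan_Elimination"
begin

definition PD :: "nat \<Rightarrow> real mat set" where
  "PD r = {Y \<in> carrier_mat r r. transpose_mat Y = Y \<and>
     (\<forall>v\<in>carrier_vec r. v \<noteq> 0\<^sub>v r \<longrightarrow> v \<bullet> (Y *\<^sub>v v) > 0)}"

text \<open>
  The type of matrices is not an additive monoid, so finite sums of
  \<open>r \<times> c\<close> matrices are formed entrywise.
\<close>

definition msum :: "nat \<Rightarrow> nat \<Rightarrow> ('b \<Rightarrow> real mat) \<Rightarrow> 'b set \<Rightarrow> real mat" where
  "msum r c F S = mat r c (\<lambda>(s, t). \<Sum>x\<in>S. F x $$ (s, t))"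

text \<open>
  The vertices are \<open>{1..k}\<close> and \<open>{1..m}\<close>, with dimensions \<open>d i\<close> and \<open>n j\<close>. The set
  \<open>A i j\<close> consists of the arrows from \<open>i\<close> to \<open>j\<close>; values of \<open>d\<close>, \<open>n\<close>, \<open>A\<close> and \<open>p\<close>
  at other indices play no role.
\<close>

definition quiver_shape ::
    "nat \<Rightarrow> nat \<Rightarrow> (nat \<Rightarrow> nat) \<Rightarrow> (nat \<Rightarrow> nat) \<Rightarrow> (nat \<Rightarrow> nat \<Rightarrow> 'a set) \<Rightarrow> bool" where
  "quiver_shape k m d n A \<longleftrightarrow>
     k > 0 \<and> m > 0 \<and> (\<forall>i\<in>{1..k}. d i > 0) \<and> (\<forall>j\<in>{1..m}. n j > 0) \<and>
     (\<forall>i\<in>{1..k}. \<forall>j\<in>{1..m}. finite (A i j)) \<and>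
     disjoint_family_on (\<lambda>(i, j). A i j) ({1..k} \<times> {1..m})"

definition arrows :: "nat \<Rightarrow> nat \<Rightarrow> (nat \<Rightarrow> nat \<Rightarrow> 'a set) \<Rightarrow> 'a set" where
  "arrows k m A = (\<Union>i\<in>{1..k}. \<Union>j\<in>{1..m}. A i j)"

text \<open>
  The tuples are \<open>extensional\<close> outside the arrow set, so that equality of functions
  in this space is equality of tuples.
\<close>

definition matrix_tuples ::
    "nat \<Rightarrow> nat \<Rightarrow> (nat \<Rightarrow> nat) \<Rightarrow> (nat \<Rightarrow> nat) \<Rightarrow> (nat \<Rightarrow> nat \<Rightarrow> 'a set) \<Rightarrow> ('a \<Rightarrow> real mat) set" where
  "matrix_tuples k m d n A = {V \<in> extensional (arrows k m A).
     \<forall>i\<in>{1..k}. \<forall>j\<in>{1..m}. \<forall>a\<in>A i j. V a \<in> carrier_mat (n j) (d i)}"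

definition tuple_add :: "'a set \<Rightarrow> ('a \<Rightarrow> real mat) \<Rightarrow> ('a \<Rightarrow> real mat) \<Rightarrow> 'a \<Rightarrow> real mat" where
  "tuple_add S V W = (\<lambda>a\<in>S. V a + W a)"

definition tuple_diff :: "'a set \<Rightarrow> ('a \<Rightarrow> real mat) \<Rightarrow> ('a \<Rightarrow> real mat) \<Rightarrow> 'a \<Rightarrow> real mat" where
  "tuple_diff S V W = (\<lambda>a\<in>S. V a - W a)"

definition tuple_smult :: "'a set \<Rightarrow> real \<Rightarrow> ('a \<Rightarrow> real mat) \<Rightarrow> 'a \<Rightarrow> real mat" where
  "tuple_smult S c V = (\<lambda>a\<in>S. c \<cdot>\<^sub>m V a)"

definition tuple_norm ::
    "nat \<Rightarrow> nat \<Rightarrow> (nat \<Rightarrow> nat) \<Rightarrow> (nat \<Rightarrow> nat) \<Rightarrow> (nat \<Rightarrow> nat \<Rightarrow> 'a set) \<Rightarrow>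
      (('a \<Rightarrow> real mat) \<Rightarrow> real) \<Rightarrow> bool" where
  "tuple_norm k m d n A \<nu> \<longleftrightarrow>
     (\<forall>V\<in>matrix_tuples k m d n A. \<nu> V \<ge> 0 \<and>
        (\<nu> V = 0 \<longleftrightarrow> (\<forall>i\<in>{1..k}. \<forall>j\<in>{1..m}. \<forall>a\<in>A i j. V a = 0\<^sub>m (n j) (d i)))) \<and>
     (\<forall>c. \<forall>V\<in>matrix_tuples k m d n A. \<nu> (tuple_smult (arrows k m A) c V) = \<bar>c\<bar> * \<nu> V) \<and>
     (\<forall>V\<in>matrix_tuples k m d n A. \<forall>W\<in>matrix_tuples k m d n A.
        \<nu> (tuple_add (arrows k m A) V W) \<le> \<nu> V + \<nu> W)"

definition quiver_datum ::
    "nat \<Rightarrow> nat \<Rightarrow> (nat \<Rightarrow> nat) \<Rightarrow> (nat \<Rightarrow> nat) \<Rightarrow> (nat \<Rightarrow> nat \<Rightarrow> 'a set) \<Rightarrow>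
      ('a \<Rightarrow> real mat) \<Rightarrow> (nat \<Rightarrow> real) \<Rightarrow> bool" where
  "quiver_datum k m d n A V p \<longleftrightarrow>
     quiver_shape k m d n A \<and> V \<in> matrix_tuples k m d n A \<and> (\<forall>j\<in>{1..m}. p j > 0) \<and>
     (\<Sum>i\<in>{1..k}. real (d i)) = (\<Sum>j\<in>{1..m}. p j * real (n j))"

text \<open>
  For a quiver datum the infimum is over a nonempty set of nonnegative reals, so it
  is a genuine infimum in \<open>real\<close>.
\<close>

definition capacity ::
    "nat \<Rightarrow> nat \<Rightarrow> (nat \<Rightarrow> nat) \<Rightarrow> (nat \<Rightarrow> nat) \<Rightarrow> (nat \<Rightarrow> nat \<Rightarrow> 'a set) \<Rightarrow>
      ('a \<Rightarrow> real mat) \<Rightarrow> (nat \<Rightarrow> real) \<Rightarrow> real" where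
  "capacity k m d n A V p = (INF Y\<in>{Y. \<forall>j\<in>{1..m}. Y j \<in> PD (n j)}.
     (\<Prod>i\<in>{1..k}. det (msum (d i) (d i)
        (\<lambda>j. p j \<cdot>\<^sub>m msum (d i) (d i) (\<lambda>a. transpose_mat (V a) * Y j * V a) (A i j)) {1..m})) /
     (\<Prod>j\<in>{1..m}. det (Y j) powr p j))"

definition feasible_datum ::
    "nat \<Rightarrow> nat \<Rightarrow> (nat \<Rightarrow> nat) \<Rightarrow> (nat \<Rightarrow> nat) \<Rightarrow> (nat \<Rightarrow> nat \<Rightarrow> 'a set) \<Rightarrow>
      ('a \<Rightarrow> real mat) \<Rightarrow> (nat \<Rightarrow> real) \<Rightarrow> bool" where
  "feasible_datum k m d n A V p \<longleftrightarrow>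
     quiver_datum k m d n A V p \<and> capacity k m d n A V p > 0"

definition equivalent_tuples ::
    "nat \<Rightarrow> nat \<Rightarrow> (nat \<Rightarrow> nat) \<Rightarrow> (nat \<Rightarrow> nat) \<Rightarrow> (nat \<Rightarrow> nat \<Rightarrow> 'a set) \<Rightarrow>
      ('a \<Rightarrow> real mat) \<Rightarrow> ('a \<Rightarrow> real mat) \<Rightarrow> bool" where
  "equivalent_tuples k m d n A V V' \<longleftrightarrow>
     V \<in> matrix_tuples k m d n A \<and> V' \<in> matrix_tuples k m d n A \<and>
     (\<exists>M N. (\<forall>i\<in>{1..k}. M i \<in> carrier_mat (d i) (d i) \<and> invertible_mat (M i)) \<and>
       (\<forall>j\<in>{1..m}. N j \<in> carrier_mat (n j) (n j) \<and> invertible_mat (N j)) \<and>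
       (\<forall>i\<in>{1..k}. \<forall>j\<in>{1..m}. \<forall>a\<in>A i j. V' a = N j * V a * the (mat_inverse (M i))))"

definition geometric_datum ::
    "nat \<Rightarrow> nat \<Rightarrow> (nat \<Rightarrow> nat) \<Rightarrow> (nat \<Rightarrow> nat) \<Rightarrow> (nat \<Rightarrow> nat \<Rightarrow> 'a set) \<Rightarrow>
      ('a \<Rightarrow> real mat) \<Rightarrow> (nat \<Rightarrow> real) \<Rightarrow> bool" where
  "geometric_datum k m d n A V p \<longleftrightarrow>
     quiver_datum k m d n A V p \<and>
     (\<forall>i\<in>{1..k}. msum (d i) (d i)
        (\<lambda>j. p j \<cdot>\<^sub>m msum (d i) (d i) (\<lambda>a. transpose_mat (V a) * V a) (A i j)) {1..m}
        = 1\<^sub>m (d i)) \<and>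
     (\<forall>j\<in>{1..m}. msum (n j) (n j)
        (\<lambda>i. msum (n j) (n j) (\<lambda>a. V a * transpose_mat (V a)) (A i j)) {1..k}
        = 1\<^sub>m (n j))"

end

theory Submission
  imports Defs
begin

text \<open>
  Write \<open>F\<^sub>i(V, Y)\<close> for the matrix \<open>\<Sum>\<^sub>j p\<^sub>j \<Sum>\<^sub>a V\<^sub>a\<^sup>T Y\<^sub>j V\<^sub>a\<close> at the source \<open>i\<close> and \<open>f\<^sub>V(Y)\<close> for the
  quotient \<open>\<Prod>\<^sub>i det F\<^sub>i(V, Y) / \<Prod>\<^sub>j det Y\<^sub>j powr p\<^sub>j\<close>, whose infimum is the capacity.

  If \<open>f\<^sub>V\<close> attained its infimum at \<open>Y\<close>, then the change of bases given by factorisations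
  \<open>Y\<^sub>j = N\<^sub>j\<^sup>T N\<^sub>j\<close> and \<open>F\<^sub>i(V, Y) = M\<^sub>i\<^sup>T M\<^sub>i\<close> would move the minimiser to the identity, where the value
  is \<open>1\<close>, and geometricity would be the first-order condition there. In general the infimum
  is not attained, but the same change of bases can be made at a \<open>Y\<close> with \<open>f\<^sub>V(Y)\<close> close to the
  capacity. The resulting tuple \<open>V'\<close>, with entries \<open>N\<^sub>j V\<^sub>a M\<^sub>i\<^sup>-\<^sup>1\<close>, is equivalent to \<open>V\<close>, satisfies
  the first half \<open>F\<^sub>i(V', 1) = 1\<close> of the geometric condition exactly, and has \<open>f\<^sub>V'(Y) \<ge> c\<close> for all
  \<open>Y\<close>, with \<open>c < 1\<close> as close to \<open>1\<close> as desired (\<open>nearly_extremal_equivalent\<close>). This is where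
  positivity of the capacity enters: values within a factor \<open>1 / c\<close> of the infimum exist.

  The condition \<open>F\<^sub>i(V', 1) = 1\<close> bounds all entries of \<open>V'\<close>, because every \<open>p\<^sub>j\<close> is positive. Hence
  the tuples \<open>V'\<close> for \<open>c \<rightarrow> 1\<close> accumulate at some \<open>G\<close>
  (\<open>isometric_convergent_subsequence\<close>), which inherits \<open>F\<^sub>i(G, 1) = 1\<close> and \<open>f\<^sub>G \<ge> 1\<close>.
  Now \<open>f\<^sub>G\<close> does attain its infimum at the identity, and the first-order condition is the other
  half of the geometric condition (\<open>extremal_first_order_condition\<close>): varying a single
  \<open>Y\<^sub>j = N\<^sup>T N\<close> along \<open>N = 1 + t E\<^sub>s\<^sub>u\<close> and using \<open>det F \<le> exp (tr F - dim F)\<close> gives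
  \<open>(1 + \<delta>\<^sub>s\<^sub>u t)\<^sup>2 \<le> exp (2 t Q\<^sub>s\<^sub>u + t\<^sup>2 Q\<^sub>u\<^sub>u)\<close> for \<open>Q = \<Sum>\<^sub>i \<Sum>\<^sub>a G\<^sub>a G\<^sub>a\<^sup>T\<close> and all small \<open>t\<close>, which forces
  \<open>Q\<^sub>s\<^sub>u = \<delta>\<^sub>s\<^sub>u\<close>. Entrywise convergence is convergence in every norm (\<open>tuple_norm_limit\<close>).
\<close>

section \<open>Positive definite matrices\<close>

lemma bilinear_form_entries:
  assumes "Y \<in> carrier_mat r r" "v \<in> carrier_vec r"
  shows "w \<bullet> (Y *\<^sub>v v) = (\<Sum>s<r. \<Sum>t<r. w $ s * Y $$ (s, t) * v $ t)"
proof -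
  have "w \<bullet> (Y *\<^sub>v v) = (\<Sum>s<r. w $ s * (\<Sum>t<r. Y $$ (s, t) * v $ t))"
    using assms by (simp add: scalar_prod_def lessThan_atLeast0)
  then show ?thesis by (simp add: sum_distrib_left mult.assoc)
qed

lemma gram_entry:
  assumes "N \<in> carrier_mat q r" "s < r" "t < r"
  shows "(transpose_mat N * N) $$ (s, t) = (\<Sum>l<q. N $$ (l, s) * N $$ (l, t))"
  using assms by (simp add: scalar_prod_def lessThan_atLeast0)

text \<open>
  Completing the square: for fixed \<open>w\<close>, the form of \<open>Y\<close> at the vector with tail \<open>w\<close> is smallest
  when the first coordinate is \<open>- b / a\<close>, where \<open>a = Y\<^sub>0\<^sub>0\<close> and \<open>b = \<Sum>\<^sub>t Y\<^sub>0\<^sub>t w\<^sub>t\<close>, and that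
  smallest value is the form of the Schur complement at \<open>w\<close>.
\<close>

lemma schur_complement_PD:
  assumes Y: "Y \<in> PD (Suc r)"
  shows "mat r r (\<lambda>(s, t). Y $$ (Suc s, Suc t) - Y $$ (0, Suc s) * Y $$ (0, Suc t) / Y $$ (0, 0)) \<in> PD r"
    (is "?C \<in> PD r") and "Y $$ (0, 0) > 0"
proof -
  have carrier: "Y \<in> carrier_mat (Suc r) (Suc r)" and tr: "transpose_mat Y = Y"
    and pos: "\<And>v. v \<in> carrier_vec (Suc r) \<Longrightarrow> v \<noteq> 0\<^sub>v (Suc r) \<Longrightarrow> v \<bullet> (Y *\<^sub>v v) > 0"
    using Y by (auto simp: PD_def)
  have sym: "Y $$ (s, t) = Y $$ (t, s)" if "s < Suc r" "t < Suc r" for s t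
    using tr carrier that by (metis index_transpose_mat(1) carrier_matD)
  define a where "a = Y $$ (0, 0)"
  have form: "v \<bullet> (Y *\<^sub>v v) = a * (v $ 0)\<^sup>2 + 2 * v $ 0 * (\<Sum>t<r. Y $$ (0, Suc t) * v $ Suc t)
     + (\<Sum>s<r. \<Sum>t<r. v $ Suc s * Y $$ (Suc s, Suc t) * v $ Suc t)"
    if "v \<in> carrier_vec (Suc r)" for v
  proof -
    have "(\<Sum>s<r. v $ Suc s * Y $$ (Suc s, 0) * v $ 0) = v $ 0 * (\<Sum>t<r. Y $$ (0, Suc t) * v $ Suc t)"
      unfolding sum_distrib_left by (intro sum.cong) (auto simp: sym)
    moreover have "(\<Sum>t<r. v $ 0 * Y $$ (0, Suc t) * v $ Suc t) = v $ 0 * (\<Sum>t<r. Y $$ (0, Suc t) * v $ Suc t)"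
      unfolding sum_distrib_left by (intro sum.cong) auto
    ultimately show ?thesis
      unfolding bilinear_form_entries[OF carrier that] sum.lessThan_Suc_shift o_def sum.distrib a_def
      by (simp add: power2_eq_square)
  qed
  have "unit_vec (Suc r) 0 \<noteq> (0\<^sub>v (Suc r) :: real vec)"
    by simp
  then have "unit_vec (Suc r) 0 \<bullet> (Y *\<^sub>v unit_vec (Suc r) 0) > 0"
    by (intro pos) auto
  then have a: "a > 0" by (subst (asm) form) auto
  then show "Y $$ (0, 0) > 0" by (simp add: a_def)
  have "w \<bullet> (?C *\<^sub>v w) > 0" if w: "w \<in> carrier_vec r" "w \<noteq> 0\<^sub>v r" for w
  proof -
    define b where "b = (\<Sum>t<r. Y $$ (0, Suc t) * w $ t)"
    define v where "v = vec (Suc r) (\<lambda>s. case s of 0 \<Rightarrow> - b / a | Suc s \<Rightarrow> w $ s)"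
    have v: "v \<in> carrier_vec (Suc r)" "v $ 0 = - b / a" "\<And>s. s < r \<Longrightarrow> v $ Suc s = w $ s"
      by (auto simp: v_def)
    have "v \<noteq> 0\<^sub>v (Suc r)"
    proof
      assume "v = 0\<^sub>v (Suc r)"
      then have "w $ s = 0" if "s < r" for s using v(3)[OF that] that by simp
      then show False using w by (auto intro: eq_vecI)
    qed
    then have "0 < v \<bullet> (Y *\<^sub>v v)" using v pos by blast
    also have "\<dots> = (\<Sum>s<r. \<Sum>t<r. w $ s * Y $$ (Suc s, Suc t) * w $ t) - b * b / a"
    proof -
      have "(\<Sum>t<r. Y $$ (0, Suc t) * v $ Suc t) = b" unfolding b_def using v(3) by simp
      moreover have "(\<Sum>s<r. \<Sum>t<r. v $ Suc s * Y $$ (Suc s, Suc t) * v $ Suc t)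
          = (\<Sum>s<r. \<Sum>t<r. w $ s * Y $$ (Suc s, Suc t) * w $ t)"
        using v(3) by simp
      ultimately show ?thesis
        using a unfolding form[OF v(1)] v(2) by (simp add: field_simps power2_eq_square)
    qed
    also have "b * b / a = (\<Sum>s<r. \<Sum>t<r. w $ s * (Y $$ (0, Suc s) * Y $$ (0, Suc t) / a) * w $ t)"
      unfolding b_def sum_product sum_divide_distrib by (intro sum.cong refl) simp
    also have "(\<Sum>s<r. \<Sum>t<r. w $ s * Y $$ (Suc s, Suc t) * w $ t) - \<dots> = w \<bullet> (?C *\<^sub>v w)"
      by (subst bilinear_form_entries[OF _ w(1)])
        (auto simp: sum_subtractf[symmetric] a_def algebra_simps intro!: sum.cong)
    finally show ?thesis .
  qed
  moreover have "transpose_mat ?C = ?C"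
    by (intro eq_matI) (auto simp: sym[of "Suc _" "Suc _"])
  ultimately show "?C \<in> PD r" by (auto simp: PD_def)
qed

text \<open>
  A triangular factor serves two purposes: it provides the change of bases that turns a positive
  definite matrix into the identity, and it makes determinants comparable with
  traces, since the determinant only sees the diagonal of the factor. The factor is built from
  the row \<open>Y\<^sub>0\<^sub>t / sqrt Y\<^sub>0\<^sub>0\<close> on top of a factor of the Schur complement.
\<close>

lemma cholesky:
  assumes "Y \<in> PD r"
  shows "\<exists>N\<in>carrier_mat r r. upper_triangular N \<and> (\<forall>s<r. N $$ (s, s) > 0) \<and> transpose_mat N * N = Y"
  using assms
proof (induction r arbitrary: Y)
  case 0
  then show ?case by (intro bexI[of _ "1\<^sub>m 0"]) (auto simp: PD_def)
next
  case (Suc r)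
  let ?C = "mat r r (\<lambda>(s, t). Y $$ (Suc s, Suc t) - Y $$ (0, Suc s) * Y $$ (0, Suc t) / Y $$ (0, 0))"
  obtain M where M: "M \<in> carrier_mat r r" "upper_triangular M" "\<And>s. s < r \<Longrightarrow> M $$ (s, s) > 0"
      "transpose_mat M * M = ?C"
    using Suc.IH[OF schur_complement_PD(1)[OF Suc.prems]] by blast
  have a: "Y $$ (0, 0) > 0" by (rule schur_complement_PD(2)[OF Suc.prems])
  have Y: "Y \<in> carrier_mat (Suc r) (Suc r)" "transpose_mat Y = Y" using Suc.prems by (auto simp: PD_def)
  have sym: "Y $$ (s, t) = Y $$ (t, s)" if "s < Suc r" "t < Suc r" for s t
    using Y that by (metis index_transpose_mat(1) carrier_matD)
  define N where "N = mat (Suc r) (Suc r) (\<lambda>(s, t).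
     case s of 0 \<Rightarrow> Y $$ (0, t) / sqrt (Y $$ (0, 0)) | Suc s' \<Rightarrow> (case t of 0 \<Rightarrow> 0 | Suc t' \<Rightarrow> M $$ (s', t')))"
  have N: "N \<in> carrier_mat (Suc r) (Suc r)" by (simp add: N_def)
  have N0: "N $$ (0, t) = Y $$ (0, t) / sqrt (Y $$ (0, 0))" if "t < Suc r" for t
    using that by (simp add: N_def)
  have NS: "N $$ (Suc s, Suc t) = M $$ (s, t)" "N $$ (Suc s, 0) = 0" if "t < r" "s < r" for s t
    using that by (auto simp: N_def)
  have "transpose_mat N * N = Y"
  proof (rule eq_matI)
    fix s t assume "s < dim_row Y" "t < dim_col Y"
    then have st: "s < Suc r" "t < Suc r" using Y by auto
    have gramN: "(transpose_mat N * N) $$ (s, t) = Y $$ (0, s) * Y $$ (0, t) / Y $$ (0, 0)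
        + (\<Sum>l<r. N $$ (Suc l, s) * N $$ (Suc l, t))"
      unfolding gram_entry[OF N st] sum.lessThan_Suc_shift o_def using a st by (simp add: N0)
    show "(transpose_mat N * N) $$ (s, t) = Y $$ (s, t)"
    proof (cases "s = 0 \<or> t = 0")
      case True
      then have "(\<Sum>l<r. N $$ (Suc l, s) * N $$ (Suc l, t)) = 0"
        by (intro sum.neutral) (auto simp: N_def)
      with True gramN a show ?thesis using sym[OF st] by auto
    next
      case False
      then obtain s' t' where s't': "s = Suc s'" "t = Suc t'" by (meson not0_implies_Suc)
      have "(\<Sum>l<r. N $$ (Suc l, s) * N $$ (Suc l, t)) = (\<Sum>l<r. M $$ (l, s') * M $$ (l, t'))"
        using st s't' by (intro sum.cong) (auto simp: NS)
      also have "\<dots> = ?C $$ (s', t')" using M(4) gram_entry[OF M(1), of s' t'] st s't' by simp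
      finally show ?thesis using gramN st s't' by simp
    qed
  qed (use N Y in auto)
  moreover have "upper_triangular N"
    using M(1,2) by (intro upper_triangularI) (auto simp: N_def split: nat.splits)
  moreover have "N $$ (s, s) > 0" if "s < Suc r" for s
    using that a M(3) by (cases s) (auto simp: N_def)
  ultimately show ?case using N by blast
qed

lemma det_upper_triangular_prod:
  assumes "N \<in> carrier_mat r r" "upper_triangular N"
  shows "det N = (\<Prod>s<r. N $$ (s, s))"
  using det_upper_triangular[OF assms(2,1)] assms(1)
  by (simp add: prod_list_diag_prod lessThan_atLeast0)

lemma PD_factor:
  assumes "Y \<in> PD r"
  obtains N where "N \<in> carrier_mat r r" "det N > 0" "transpose_mat N * N = Y"
proof -
  obtain N where N: "N \<in> carrier_mat r r" "upper_triangular N" "\<forall>s<r. N $$ (s, s) > 0"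
      "transpose_mat N * N = Y"
    using cholesky[OF assms] by blast
  then have "det N > 0" unfolding det_upper_triangular_prod[OF N(1,2)] by (intro prod_pos) auto
  with N that show ?thesis by blast
qed

lemma det_gram: "N \<in> carrier_mat r r \<Longrightarrow> det (transpose_mat N * N) = (det N :: real)\<^sup>2"
  by (simp add: det_mult det_transpose power2_eq_square)

lemma PD_det_pos:
  assumes "Y \<in> PD r"
  shows "det Y > 0"
proof -
  obtain N where "N \<in> carrier_mat r r" "det N > 0" "transpose_mat N * N = Y"
    using assms by (rule PD_factor)
  then show ?thesis using det_gram[of N r] by simp
qed

text \<open>
  With a triangular factor \<open>N\<close> the determinant is \<open>\<Prod>\<^sub>s N\<^sub>s\<^sub>s\<^sup>2\<close>, and \<open>N\<^sub>s\<^sub>s\<^sup>2\<close> is one of the squares that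
  add up to \<open>Y\<^sub>s\<^sub>s\<close>; this is Hadamard's inequality. Then \<open>x \<le> exp (x - 1)\<close> on each diagonal
  entry gives a bound that is an equality to first order at the identity.
\<close>

lemma PD_det_le_exp_trace:
  assumes "Y \<in> PD r"
  shows "det Y \<le> exp ((\<Sum>s<r. Y $$ (s, s)) - real r)"
proof -
  obtain N where N: "N \<in> carrier_mat r r" "upper_triangular N" "\<forall>s<r. N $$ (s, s) > 0"
      "transpose_mat N * N = Y"
    using cholesky[OF assms] by blast
  have "det Y = (\<Prod>s<r. (N $$ (s, s))\<^sup>2)"
    using det_gram[OF N(1)] N(4) det_upper_triangular_prod[OF N(1,2)] by (simp add: prod_power_distrib)
  also have "\<dots> \<le> (\<Prod>s<r. exp (Y $$ (s, s) - 1))"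
  proof (rule prod_mono, safe)
    fix s assume "s < r"
    have "(N $$ (s, s))\<^sup>2 \<le> (\<Sum>l<r. (N $$ (l, s))\<^sup>2)"
      using \<open>s < r\<close> by (intro member_le_sum) auto
    also have "\<dots> = Y $$ (s, s)"
      using gram_entry[OF N(1) \<open>s < r\<close> \<open>s < r\<close>] N(4) by (simp add: power2_eq_square)
    finally have "(N $$ (s, s))\<^sup>2 \<le> Y $$ (s, s)" .
    then show "(N $$ (s, s))\<^sup>2 \<le> exp (Y $$ (s, s) - 1)"
      using exp_ge_add_one_self[of "Y $$ (s, s) - 1"] by linarith
  qed simp
  also have "\<dots> = exp ((\<Sum>s<r. Y $$ (s, s)) - real r)"
    by (simp add: exp_sum[symmetric] sum_subtractf)
  finally show ?thesis .
qed

lemma PD_one: "1\<^sub>m r \<in> PD r"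
proof -
  have "v \<bullet> (1\<^sub>m r *\<^sub>v v) > 0" if "v \<in> carrier_vec r" "v \<noteq> 0\<^sub>v r" for v :: "real vec"
    using that conjugate_square_greater_0_vec[of v r] by simp
  then show ?thesis by (simp add: PD_def)
qed

lemma congruence_form:
  fixes Z :: "real mat"
  assumes "Z \<in> carrier_mat q q" "N \<in> carrier_mat q r" "v \<in> carrier_vec r" "w \<in> carrier_vec r"
  shows "w \<bullet> ((transpose_mat N * Z * N) *\<^sub>v v) = (N *\<^sub>v w) \<bullet> (Z *\<^sub>v (N *\<^sub>v v))"
proof -
  have "(transpose_mat N * Z * N) *\<^sub>v v = transpose_mat N *\<^sub>v (Z *\<^sub>v (N *\<^sub>v v))"
    using assms by (simp add: assoc_mult_mat_vec[of _ r q _ r] assoc_mult_mat_vec[of _ r q _ q])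
  moreover have "w \<bullet> (transpose_mat N *\<^sub>v (Z *\<^sub>v (N *\<^sub>v v))) = (Z *\<^sub>v (N *\<^sub>v v)) \<bullet> (N *\<^sub>v w)"
    using assms transpose_vec_mult_scalar[of N q r w "Z *\<^sub>v (N *\<^sub>v v)"]
      comm_scalar_prod[of w r "transpose_mat N *\<^sub>v (Z *\<^sub>v (N *\<^sub>v v))"]
    by simp
  ultimately show ?thesis
    using assms comm_scalar_prod[of "N *\<^sub>v w" q "Z *\<^sub>v (N *\<^sub>v v)"] by simp
qed

lemma det_nonzero_kernel:
  fixes N :: "real mat"
  assumes "N \<in> carrier_mat r r" "det N \<noteq> 0" "v \<in> carrier_vec r" "N *\<^sub>v v = 0\<^sub>v r"
  shows "v = 0\<^sub>v r"
  using assms det_0_iff_vec_prod_zero_field[of N r] by blast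

lemma congruence_symmetric:
  fixes Z :: "real mat"
  assumes "Z \<in> carrier_mat q q" "transpose_mat Z = Z" "N \<in> carrier_mat q r"
  shows "transpose_mat (transpose_mat N * Z * N) = transpose_mat N * Z * N"
  using assms transpose_mult[of "transpose_mat N * Z" r q N r] transpose_mult[of "transpose_mat N" r q Z q]
    assoc_mult_mat[of "transpose_mat N" r q Z q N r]
  by simp

lemma PD_congruence:
  assumes Z: "Z \<in> PD r" and N: "N \<in> carrier_mat r r" "det N \<noteq> 0"
  shows "transpose_mat N * Z * N \<in> PD r"
proof -
  have Zc: "Z \<in> carrier_mat r r" and Zt: "transpose_mat Z = Z"
    and Zp: "\<And>v. v \<in> carrier_vec r \<Longrightarrow> v \<noteq> 0\<^sub>v r \<Longrightarrow> v \<bullet> (Z *\<^sub>v v) > 0"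
    using Z by (auto simp: PD_def)
  have "v \<bullet> ((transpose_mat N * Z * N) *\<^sub>v v) > 0" if v: "v \<in> carrier_vec r" "v \<noteq> 0\<^sub>v r" for v
    unfolding congruence_form[OF Zc N(1) v(1) v(1)]
    using det_nonzero_kernel[OF N v(1)] v by (intro Zp mult_mat_vec_carrier[OF N(1)]) auto
  moreover note congruence_symmetric[OF Zc Zt N(1)]
  ultimately show ?thesis using N(1) Zc by (auto simp: PD_def)
qed

lemma det_congruence:
  fixes Z :: "real mat"
  assumes "Z \<in> carrier_mat r r" "N \<in> carrier_mat r r"
  shows "det (transpose_mat N * Z * N) = det Z * (det N)\<^sup>2"
  using assms det_mult[of "transpose_mat N * Z" r N] det_mult[of "transpose_mat N" r Z] det_transpose[of N r]
  by (simp add: power2_eq_square)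

text \<open>
  Comparing bilinear forms replaces the manipulation of sums of matrices by that of sums of
  numbers.
\<close>

lemma mat_eq_of_forms:
  fixes X X' :: "real mat"
  assumes X: "X \<in> carrier_mat r r" and X': "X' \<in> carrier_mat r r"
    and eq: "\<And>w v. w \<in> carrier_vec r \<Longrightarrow> v \<in> carrier_vec r \<Longrightarrow> w \<bullet> (X *\<^sub>v v) = w \<bullet> (X' *\<^sub>v v)"
  shows "X = X'"
proof (rule eq_matI)
  fix s t assume "s < dim_row X'" "t < dim_col X'"
  then have st: "s < r" "t < r" using X' by auto
  have entry: "unit_vec r s \<bullet> (U *\<^sub>v unit_vec r t) = U $$ (s, t)" if "U \<in> carrier_mat r r" for U :: "real mat"
    using st that by simp
  show "X $$ (s, t) = X' $$ (s, t)"
    using eq[of "unit_vec r s" "unit_vec r t"] entry[OF X] entry[OF X'] by simp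
qed (use X X' in auto)

lemma det_nonzero_mat_inverse:
  fixes M :: "real mat"
  assumes M: "M \<in> carrier_mat r r" and det: "det M \<noteq> 0"
  shows "invertible_mat M" "the (mat_inverse M) \<in> carrier_mat r r"
    "M * the (mat_inverse M) = 1\<^sub>m r"
proof -
  have "mat_inverse M \<noteq> None"
    using mat_inverse(1)[OF M, where b = "()"] det_non_zero_imp_unit[OF M det, where b = "()"] by blast
  then obtain B where B: "mat_inverse M = Some B" by auto
  have inv: "M * B = 1\<^sub>m r" "B * M = 1\<^sub>m r" "B \<in> carrier_mat r r"
    using mat_inverse(2)[OF M B] by auto
  then show "the (mat_inverse M) \<in> carrier_mat r r"
    "M * the (mat_inverse M) = 1\<^sub>m r"
    using B by auto
  show "invertible_mat M"
    unfolding invertible_mat_def inverts_mat_def using M inv by (auto intro!: exI[of _ B])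
qed

lemma congruence_entry:
  fixes Z :: "real mat"
  assumes "Z \<in> carrier_mat q q" "N \<in> carrier_mat q r" "s < r" "t < r"
  shows "(transpose_mat N * Z * N) $$ (s, t) = (\<Sum>l<q. N $$ (l, s) * (\<Sum>l'<q. Z $$ (l, l') * N $$ (l', t)))"
  using assms by (simp add: scalar_prod_def lessThan_atLeast0)

text \<open>
  Adding \<open>t\<close> times row \<open>u\<close> to row \<open>s\<close> changes the sum of the squares of all entries of \<open>V\<close> by an
  expression in the Gram matrix of the rows, and its linear term in \<open>t\<close> isolates the entry
  \<open>(s, u)\<close>. For \<open>s = u\<close> the operation scales row \<open>s\<close> by \<open>1 + t\<close>, and the formula is the
  same. The factor \<open>1\<^sub>m q\<close> is kept to match congruence transforms of the identity.
\<close>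

lemma trace_addrow_congruence:
  fixes V :: "real mat" and t :: real
  assumes V: "V \<in> carrier_mat q r" and s: "s < q" and u: "u < q"
  defines "N \<equiv> addrow_mat q t s u"
  shows "(\<Sum>c<r. (transpose_mat V * (transpose_mat N * 1\<^sub>m q * N) * V) $$ (c, c)) =
    (\<Sum>c<r. (transpose_mat V * 1\<^sub>m q * V) $$ (c, c))
      + 2 * t * (V * transpose_mat V) $$ (s, u) + t\<^sup>2 * (V * transpose_mat V) $$ (u, u)"
proof -
  have N: "N \<in> carrier_mat q q" by (simp add: N_def addrow_mat_def)
  have NV: "N * V = addrow t s u V" unfolding N_def by (rule addrow_mat[OF V u, symmetric])
  have gram: "transpose_mat V * (transpose_mat N * 1\<^sub>m q * N) * V = transpose_mat (N * V) * (N * V)"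
    using N V transpose_mult[OF N V]
    by (simp add: assoc_mult_mat[of _ r q _ q _ q] assoc_mult_mat[of _ r q _ q _ r] assoc_mult_mat[of _ q q _ q _ r])
  have "(transpose_mat V * (transpose_mat N * 1\<^sub>m q * N) * V) $$ (c, c) =
      (transpose_mat V * 1\<^sub>m q * V) $$ (c, c)
        + (2 * t * (V $$ (s, c) * V $$ (u, c)) + t\<^sup>2 * (V $$ (u, c) * V $$ (u, c)))" if c: "c < r" for c
  proof -
    have "(transpose_mat (N * V) * (N * V)) $$ (c, c) = (\<Sum>l<q. (N * V) $$ (l, c) * (N * V) $$ (l, c))"
      by (rule gram_entry) (use N V c in auto)
    also have "\<dots> = (\<Sum>l<q. V $$ (l, c) * V $$ (l, c)
        + (if l = s then 2 * t * (V $$ (s, c) * V $$ (u, c)) + t\<^sup>2 * (V $$ (u, c) * V $$ (u, c)) else 0))"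
      unfolding NV using V c u by (intro sum.cong refl) (auto simp: power2_eq_square algebra_simps)
    also have "\<dots> = (\<Sum>l<q. V $$ (l, c) * V $$ (l, c))
        + (2 * t * (V $$ (s, c) * V $$ (u, c)) + t\<^sup>2 * (V $$ (u, c) * V $$ (u, c)))"
      using s by (simp add: sum.distrib)
    finally show ?thesis using gram gram_entry[OF V c c] V by simp
  qed
  moreover have "(V * transpose_mat V) $$ (x, y) = (\<Sum>c<r. V $$ (x, c) * V $$ (y, c))"
    if "x < q" "y < q" for x y
    using V that by (simp add: scalar_prod_def lessThan_atLeast0)
  ultimately show ?thesis
    using s u by (simp add: sum.distrib sum_distrib_left)
qed

lemma det_addrow_mat_general:
  assumes "s < q" "u < q"
  shows "det (addrow_mat q t s u) = (1 + (if s = u then t else 0) :: real)"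
proof (cases "s = u")
  case True
  have "addrow_mat q t s u = multrow_mat q s (1 + t)"
    using True by (intro eq_matI) auto
  then show ?thesis using True assms by (simp add: det_multrow_mat)
qed (use det_addrow_mat assms in auto)

section \<open>Real analysis\<close>

lemma tendsto_det:
  fixes X :: "nat \<Rightarrow> real mat"
  assumes X: "\<And>\<nu>. X \<nu> \<in> carrier_mat r r" and L: "L \<in> carrier_mat r r"
    and lim: "\<And>s t. s < r \<Longrightarrow> t < r \<Longrightarrow> (\<lambda>\<nu>. X \<nu> $$ (s, t)) \<longlonglongrightarrow> L $$ (s, t)"
  shows "(\<lambda>\<nu>. det (X \<nu>)) \<longlonglongrightarrow> det L"
  unfolding det_def'[OF X] det_def'[OF L]
  by (intro tendsto_intros lim) (auto dest: permutes_in_image)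

text \<open>
  Both sides equal \<open>1\<close> at \<open>t = 0\<close>, so their difference has a minimum there and the derivatives
  agree.
\<close>

lemma coefficient_from_exp_bound:
  fixes q r \<delta> :: real
  assumes bound: "\<And>t. \<bar>t\<bar> < 1 \<Longrightarrow> (1 + \<delta> * t)\<^sup>2 \<le> exp (2 * t * q + t\<^sup>2 * r)"
  shows "q = \<delta>"
proof -
  let ?g = "\<lambda>t. exp (2 * t * q + t\<^sup>2 * r) - (1 + \<delta> * t)\<^sup>2"
  have "DERIV ?g 0 :> 2 * q - 2 * \<delta>"
    by (auto intro!: derivative_eq_intros)
  moreover have "\<forall>t. \<bar>0 - t\<bar> < 1 \<longrightarrow> ?g 0 \<le> ?g t"
    using bound by simp
  ultimately have "2 * q - 2 * \<delta> = 0"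
    by (intro DERIV_local_min[of ?g _ 0 1]) auto
  then show ?thesis by simp
qed

lemma convergent_subsequence_finite:
  fixes X :: "nat \<Rightarrow> 'x \<Rightarrow> real"
  assumes "finite S" "\<And>x. x \<in> S \<Longrightarrow> Bseq (\<lambda>\<nu>. X \<nu> x)"
  shows "\<exists>\<sigma> L. strict_mono \<sigma> \<and> (\<forall>x\<in>S. (\<lambda>\<nu>. X (\<sigma> \<nu>) x) \<longlonglongrightarrow> L x)"
  using assms
proof (induction S)
  case empty
  show ?case by (intro exI[of _ id]) (auto simp: strict_mono_def)
next
  case (insert y S)
  then obtain \<sigma> L where \<sigma>: "strict_mono \<sigma>" and L: "\<forall>x\<in>S. (\<lambda>\<nu>. X (\<sigma> \<nu>) x) \<longlonglongrightarrow> L x"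
    by force
  obtain \<tau> :: "nat \<Rightarrow> nat" where \<tau>: "strict_mono \<tau>" "monoseq (\<lambda>\<nu>. X (\<sigma> (\<tau> \<nu>)) y)"
    using seq_monosub[of "\<lambda>\<nu>. X (\<sigma> \<nu>) y"] by blast
  have "Bseq (\<lambda>\<nu>. X ((\<sigma> \<circ> \<tau>) \<nu>) y)"
    using Bseq_subseq[OF insert.prems[of y], of "\<sigma> \<circ> \<tau>"] by simp
  then obtain l where l: "(\<lambda>\<nu>. X (\<sigma> (\<tau> \<nu>)) y) \<longlonglongrightarrow> l"
    using Bseq_monoseq_convergent[OF _ \<tau>(2)] by (auto simp: convergent_def)
  have "(\<lambda>\<nu>. X (\<sigma> (\<tau> \<nu>)) x) \<longlonglongrightarrow> L x" if "x \<in> S" for x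
    using LIMSEQ_subseq_LIMSEQ[OF _ \<tau>(1)] L that by (fastforce simp: o_def)
  then have "\<forall>x\<in>insert y S. (\<lambda>\<nu>. X ((\<sigma> \<circ> \<tau>) \<nu>) x) \<longlonglongrightarrow> (L(y := l)) x"
    using l insert.hyps by auto
  then show ?case using strict_mono_o[OF \<sigma> \<tau>(1)] by blast
qed

section \<open>The forms at the sources of a quiver\<close>

locale quiver =
  fixes k m :: nat and d n :: "nat \<Rightarrow> nat" and A :: "nat \<Rightarrow> nat \<Rightarrow> 'a set" and p :: "nat \<Rightarrow> real"
  assumes shape: "quiver_shape k m d n A" and p_pos: "j \<in> {1..m} \<Longrightarrow> p j > 0"
begin

abbreviation tuples :: "('a \<Rightarrow> real mat) set" where
  "tuples \<equiv> matrix_tuples k m d n A"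

definition source_form :: "('a \<Rightarrow> real mat) \<Rightarrow> (nat \<Rightarrow> real mat) \<Rightarrow> nat \<Rightarrow> real mat" where
  "source_form V Y i = msum (d i) (d i)
     (\<lambda>j. p j \<cdot>\<^sub>m msum (d i) (d i) (\<lambda>a. transpose_mat (V a) * Y j * V a) (A i j)) {1..m}"

text \<open>
  The maps \<open>sqrt p\<^sub>j V\<^sub>a\<close> out of each source together form an isometry; this is one
  half of the geometric condition.
\<close>

definition isometric :: "('a \<Rightarrow> real mat) \<Rightarrow> bool" where
  "isometric V \<longleftrightarrow> (\<forall>i\<in>{1..k}. source_form V (\<lambda>j. 1\<^sub>m (n j)) i = 1\<^sub>m (d i))"

lemma finite_arrows_between: "i \<in> {1..k} \<Longrightarrow> j \<in> {1..m} \<Longrightarrow> finite (A i j)"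
  using shape by (auto simp: quiver_shape_def)

lemma tuple_carrier:
  "V \<in> tuples \<Longrightarrow> i \<in> {1..k} \<Longrightarrow> j \<in> {1..m} \<Longrightarrow> a \<in> A i j \<Longrightarrow> V a \<in> carrier_mat (n j) (d i)"
  by (auto simp: matrix_tuples_def)

lemma arrow_ends:
  obtains src tgt :: "'a \<Rightarrow> nat"
  where "\<And>i j a. i \<in> {1..k} \<Longrightarrow> j \<in> {1..m} \<Longrightarrow> a \<in> A i j \<Longrightarrow> src a = i \<and> tgt a = j"
proof -
  define g where "g a = (SOME x. x \<in> {1..k} \<times> {1..m} \<and> a \<in> A (fst x) (snd x))" for a
  have "g a = (i, j)" if "i \<in> {1..k}" "j \<in> {1..m}" "a \<in> A i j" for i j a
  proof -
    have g: "g a \<in> {1..k} \<times> {1..m} \<and> a \<in> A (fst (g a)) (snd (g a))"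
      unfolding g_def by (rule someI[of _ "(i, j)"]) (use that in auto)
    have disj: "disjoint_family_on (\<lambda>(i, j). A i j) ({1..k} \<times> {1..m})"
      using shape by (auto simp: quiver_shape_def)
    show ?thesis
    proof (rule ccontr)
      assume "g a \<noteq> (i, j)"
      from disjoint_family_onD[OF disj _ _ this] g that show False
        by (auto simp: split_beta)
    qed
  qed
  then show thesis by (intro that[of "fst \<circ> g" "snd \<circ> g"]) auto
qed

lemma source_form_carrier [simp]: "source_form V Y i \<in> carrier_mat (d i) (d i)"
  by (simp add: source_form_def msum_def)

lemma source_form_entry:
  assumes "s < d i" "t < d i"
  shows "source_form V Y i $$ (s, t) =
    (\<Sum>j\<in>{1..m}. p j * (\<Sum>a\<in>A i j. (transpose_mat (V a) * Y j * V a) $$ (s, t)))"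
  using assms by (simp add: source_form_def msum_def)

lemma source_form_cong:
  assumes "\<And>j. j \<in> {1..m} \<Longrightarrow> Y j = Z j"
  shows "source_form V Y i = source_form V Z i"
  by (intro eq_matI) (use assms in \<open>simp_all add: source_form_def msum_def\<close>)

lemma source_form_bilinear:
  assumes V: "V \<in> tuples" and i: "i \<in> {1..k}" and Y: "\<And>j. j \<in> {1..m} \<Longrightarrow> Y j \<in> carrier_mat (n j) (n j)"
    and v: "v \<in> carrier_vec (d i)" and w: "w \<in> carrier_vec (d i)"
  shows "w \<bullet> (source_form V Y i *\<^sub>v v) =
    (\<Sum>j\<in>{1..m}. p j * (\<Sum>a\<in>A i j. (V a *\<^sub>v w) \<bullet> (Y j *\<^sub>v (V a *\<^sub>v v))))"
proof -
  let ?X = "\<lambda>j a. transpose_mat (V a) * Y j * V a"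
  have "w \<bullet> (source_form V Y i *\<^sub>v v) =
      (\<Sum>s<d i. \<Sum>t<d i. \<Sum>j\<in>{1..m}. \<Sum>a\<in>A i j. p j * (w $ s * ?X j a $$ (s, t) * v $ t))"
    unfolding bilinear_form_entries[OF source_form_carrier v]
    by (intro sum.cong refl)
      (simp add: source_form_entry sum_distrib_left sum_distrib_right algebra_simps)
  also have "\<dots> = (\<Sum>s<d i. \<Sum>j\<in>{1..m}. \<Sum>t<d i. \<Sum>a\<in>A i j. p j * (w $ s * ?X j a $$ (s, t) * v $ t))"
    by (intro sum.cong refl sum.swap)
  also have "\<dots> = (\<Sum>j\<in>{1..m}. \<Sum>s<d i. \<Sum>t<d i. \<Sum>a\<in>A i j. p j * (w $ s * ?X j a $$ (s, t) * v $ t))"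
    by (rule sum.swap)
  also have "\<dots> = (\<Sum>j\<in>{1..m}. \<Sum>s<d i. \<Sum>a\<in>A i j. \<Sum>t<d i. p j * (w $ s * ?X j a $$ (s, t) * v $ t))"
    by (intro sum.cong refl sum.swap)
  also have "\<dots> = (\<Sum>j\<in>{1..m}. \<Sum>a\<in>A i j. \<Sum>s<d i. \<Sum>t<d i. p j * (w $ s * ?X j a $$ (s, t) * v $ t))"
    by (intro sum.cong refl sum.swap)
  also have "\<dots> = (\<Sum>j\<in>{1..m}. p j * (\<Sum>a\<in>A i j. (V a *\<^sub>v w) \<bullet> (Y j *\<^sub>v (V a *\<^sub>v v))))"
  proof (intro sum.cong refl)
    fix j assume j: "j \<in> {1..m}"
    have "(\<Sum>s<d i. \<Sum>t<d i. p j * (w $ s * ?X j a $$ (s, t) * v $ t)) =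
        p j * ((V a *\<^sub>v w) \<bullet> (Y j *\<^sub>v (V a *\<^sub>v v)))" if a: "a \<in> A i j" for a
    proof -
      have Va: "V a \<in> carrier_mat (n j) (d i)" using V i j a by (rule tuple_carrier)
      have "?X j a \<in> carrier_mat (d i) (d i)"
        using Va Y[OF j] by simp
      then show ?thesis
        unfolding congruence_form[OF Y[OF j] Va v w, symmetric]
        by (subst bilinear_form_entries[OF _ v]) (simp_all add: sum_distrib_left)
    qed
    then show "(\<Sum>a\<in>A i j. \<Sum>s<d i. \<Sum>t<d i. p j * (w $ s * ?X j a $$ (s, t) * v $ t)) =
        p j * (\<Sum>a\<in>A i j. (V a *\<^sub>v w) \<bullet> (Y j *\<^sub>v (V a *\<^sub>v v)))"
      unfolding sum_distrib_left by (intro sum.cong refl)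
  qed
  finally show ?thesis .
qed

text \<open>
  The form is always positive semidefinite, and a vector on which it vanishes is killed by
  every \<open>V\<^sub>a\<close> out of \<open>i\<close>, hence lies in the kernel of the matrix.
\<close>

lemma source_form_PD:
  assumes V: "V \<in> tuples" and i: "i \<in> {1..k}" and Y: "\<And>j. j \<in> {1..m} \<Longrightarrow> Y j \<in> PD (n j)"
    and det: "det (source_form V Y i) \<noteq> 0"
  shows "source_form V Y i \<in> PD (d i)"
proof -
  let ?F = "source_form V Y i"
  have Yc: "Y j \<in> carrier_mat (n j) (n j)" and Yt: "transpose_mat (Y j) = Y j" if "j \<in> {1..m}" for j
    using Y[OF that] by (auto simp: PD_def)
  have Yp: "u \<bullet> (Y j *\<^sub>v u) \<ge> 0" "u \<bullet> (Y j *\<^sub>v u) = 0 \<Longrightarrow> u = 0\<^sub>v (n j)"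
    if "j \<in> {1..m}" "u \<in> carrier_vec (n j)" for j u
    using Y[OF that(1)] that(2) by (cases "u = 0\<^sub>v (n j)"; force simp: PD_def)+
  have "v \<bullet> (?F *\<^sub>v v) > 0" if v: "v \<in> carrier_vec (d i)" "v \<noteq> 0\<^sub>v (d i)" for v
  proof (rule ccontr)
    assume "\<not> v \<bullet> (?F *\<^sub>v v) > 0"
    moreover have Vv: "V a *\<^sub>v v \<in> carrier_vec (n j)" if "j \<in> {1..m}" "a \<in> A i j" for j a
      using tuple_carrier[OF V i that] v(1) by simp
    ultimately have le: "(\<Sum>j\<in>{1..m}. p j * (\<Sum>a\<in>A i j. (V a *\<^sub>v v) \<bullet> (Y j *\<^sub>v (V a *\<^sub>v v)))) \<le> 0"
      using source_form_bilinear[OF V i Yc v(1) v(1)] by simp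
    have nonneg: "(\<Sum>a\<in>A i j. (V a *\<^sub>v v) \<bullet> (Y j *\<^sub>v (V a *\<^sub>v v))) \<ge> 0" if "j \<in> {1..m}" for j
      using that by (intro sum_nonneg Yp Vv)
    have total: "(\<Sum>j\<in>{1..m}. p j * (\<Sum>a\<in>A i j. (V a *\<^sub>v v) \<bullet> (Y j *\<^sub>v (V a *\<^sub>v v)))) = 0"
      using le by (intro antisym sum_nonneg mult_nonneg_nonneg less_imp_le[OF p_pos] nonneg)
    have zero: "(\<Sum>a\<in>A i j. (V a *\<^sub>v v) \<bullet> (Y j *\<^sub>v (V a *\<^sub>v v))) = 0" if "j \<in> {1..m}" for j
    proof -
      have "p j * (\<Sum>a\<in>A i j. (V a *\<^sub>v v) \<bullet> (Y j *\<^sub>v (V a *\<^sub>v v))) = 0"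
        by (rule sum_nonneg_0[OF _ _ total that])
          (auto simp del: mult_nonneg_nonneg intro!: mult_nonneg_nonneg less_imp_le[OF p_pos] nonneg)
      then show ?thesis using p_pos[OF that] by simp
    qed
    have Vv0: "V a *\<^sub>v v = 0\<^sub>v (n j)" if "j \<in> {1..m}" "a \<in> A i j" for j a
    proof -
      have "(V a *\<^sub>v v) \<bullet> (Y j *\<^sub>v (V a *\<^sub>v v)) = 0"
        by (rule sum_nonneg_0[OF finite_arrows_between[OF i that(1)] _ zero[OF that(1)] that(2)])
          (rule Yp(1)[OF that(1) Vv[OF that(1)]])
      then show ?thesis by (intro Yp(2) Vv that)
    qed
    \<comment> \<open>The choice of the image of \<open>v\<close> for \<open>w\<close> shows that this image is zero.\<close>
    have "w \<bullet> (?F *\<^sub>v v) = 0" if w: "w \<in> carrier_vec (d i)" for w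
    proof -
      have "(V a *\<^sub>v w) \<bullet> (Y j *\<^sub>v (V a *\<^sub>v v)) = 0" if "j \<in> {1..m}" "a \<in> A i j" for j a
      proof -
        have "Y j *\<^sub>v 0\<^sub>v (n j) = 0\<^sub>v (n j)" using Yc[OF that(1)] by (intro eq_vecI) auto
        then show ?thesis
          using Vv0[OF that] tuple_carrier[OF V i that] w by simp
      qed
      then have "(\<Sum>a\<in>A i j. (V a *\<^sub>v w) \<bullet> (Y j *\<^sub>v (V a *\<^sub>v v))) = 0" if "j \<in> {1..m}" for j
        using that by (intro sum.neutral) blast
      then have "(\<Sum>j\<in>{1..m}. p j * (\<Sum>a\<in>A i j. (V a *\<^sub>v w) \<bullet> (Y j *\<^sub>v (V a *\<^sub>v v)))) = 0"
        by (intro sum.neutral) simp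
      then show ?thesis using source_form_bilinear[OF V i Yc v(1) w] by simp
    qed
    then have "(?F *\<^sub>v v) \<bullet> (?F *\<^sub>v v) = 0" by (metis mult_mat_vec_carrier source_form_carrier v(1))
    then have "?F *\<^sub>v v = 0\<^sub>v (d i)"
      using conjugate_square_eq_0_vec[of "?F *\<^sub>v v" "d i"] v(1)
        mult_mat_vec_carrier[OF source_form_carrier v(1)] by simp
    with det_nonzero_kernel[OF source_form_carrier det v(1)] v(2) show False by blast
  qed
  moreover have "transpose_mat ?F = ?F"
  proof (rule eq_matI)
    fix s t assume "s < dim_row ?F" "t < dim_col ?F"
    then have st: "s < d i" "t < d i" using source_form_carrier[of V Y i] by auto
    have "(transpose_mat (V a) * Y j * V a) $$ (t, s) = (transpose_mat (V a) * Y j * V a) $$ (s, t)"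
      if "j \<in> {1..m}" "a \<in> A i j" for j a
    proof -
      have Va: "V a \<in> carrier_mat (n j) (d i)" using V i that by (rule tuple_carrier)
      have "(transpose_mat (V a) * Y j * V a) $$ (t, s) =
          transpose_mat (transpose_mat (V a) * Y j * V a) $$ (s, t)"
        using Va st by (subst index_transpose_mat) auto
      then show ?thesis by (simp only: congruence_symmetric[OF Yc[OF that(1)] Yt[OF that(1)] Va])
    qed
    then have "?F $$ (t, s) = ?F $$ (s, t)"
      unfolding source_form_entry[OF st] source_form_entry[OF st(2,1)] by simp
    then show "transpose_mat ?F $$ (s, t) = ?F $$ (s, t)"
      using st carrier_matD[OF source_form_carrier[of V Y i]] by simp
  qed (use carrier_matD[OF source_form_carrier[of V Y i]] in auto)
  ultimately show ?thesis by (simp add: PD_def)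
qed

lemma source_form_det_nonneg:
  assumes "V \<in> tuples" "i \<in> {1..k}" "\<And>j. j \<in> {1..m} \<Longrightarrow> Y j \<in> PD (n j)"
  shows "det (source_form V Y i) \<ge> 0"
  using source_form_PD[OF assms] PD_det_pos by fastforce

text \<open>
  A change of bases at the targets acts on the argument \<open>Z\<close>, and a change of bases at the
  source acts on the value, in both cases by congruence. So passing to an equivalent tuple only
  rescales the capacity functional and reparametrises its domain.
\<close>

lemma source_form_congruence:
  assumes V: "V \<in> tuples" and i: "i \<in> {1..k}" and Z: "\<And>j. j \<in> {1..m} \<Longrightarrow> Z j \<in> carrier_mat (n j) (n j)"
    and N: "\<And>j. j \<in> {1..m} \<Longrightarrow> N j \<in> carrier_mat (n j) (n j)" and B: "B \<in> carrier_mat (d i) (d i)"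
    and V': "V' \<in> tuples" "\<And>j a. j \<in> {1..m} \<Longrightarrow> a \<in> A i j \<Longrightarrow> V' a = N j * V a * B"
  shows "source_form V' Z i = transpose_mat B * source_form V (\<lambda>j. transpose_mat (N j) * Z j * N j) i * B"
proof (rule mat_eq_of_forms)
  fix w v :: "real vec"
  assume w: "w \<in> carrier_vec (d i)" and v: "v \<in> carrier_vec (d i)"
  have Bwv: "B *\<^sub>v w \<in> carrier_vec (d i)" "B *\<^sub>v v \<in> carrier_vec (d i)" using B w v by auto
  have W: "transpose_mat (N j) * Z j * N j \<in> carrier_mat (n j) (n j)" if "j \<in> {1..m}" for j
    using N[OF that] Z[OF that] by simp
  have act: "V' a *\<^sub>v u = N j *\<^sub>v (V a *\<^sub>v (B *\<^sub>v u))"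
    if "j \<in> {1..m}" "a \<in> A i j" "u \<in> carrier_vec (d i)" for j a u
    using that V'(2)[OF that(1,2)] N[OF that(1)] tuple_carrier[OF V i that(1,2)] B
    by (simp add: assoc_mult_mat_vec[of _ "n j" "d i" _ "d i"] assoc_mult_mat_vec[of _ "n j" "n j" _ "d i"])
  have "w \<bullet> (source_form V' Z i *\<^sub>v v) =
      (\<Sum>j\<in>{1..m}. p j * (\<Sum>a\<in>A i j. (V' a *\<^sub>v w) \<bullet> (Z j *\<^sub>v (V' a *\<^sub>v v))))"
    by (rule source_form_bilinear[OF V'(1) i Z v w])
  also have "\<dots> = (\<Sum>j\<in>{1..m}. p j * (\<Sum>a\<in>A i j. (V a *\<^sub>v (B *\<^sub>v w)) \<bullet>
      ((transpose_mat (N j) * Z j * N j) *\<^sub>v (V a *\<^sub>v (B *\<^sub>v v)))))"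
  proof (intro sum.cong refl arg_cong2[of _ _ _ _ "(*)"])
    fix j a assume ja: "j \<in> {1..m}" "a \<in> A i j"
    have VB: "V a *\<^sub>v (B *\<^sub>v w) \<in> carrier_vec (n j)" "V a *\<^sub>v (B *\<^sub>v v) \<in> carrier_vec (n j)"
      using tuple_carrier[OF V i ja] Bwv by auto
    show "(V' a *\<^sub>v w) \<bullet> (Z j *\<^sub>v (V' a *\<^sub>v v)) = (V a *\<^sub>v (B *\<^sub>v w)) \<bullet>
        ((transpose_mat (N j) * Z j * N j) *\<^sub>v (V a *\<^sub>v (B *\<^sub>v v)))"
      unfolding act[OF ja w] act[OF ja v]
      by (rule congruence_form[OF Z[OF ja(1)] N[OF ja(1)] VB(2,1), symmetric])
  qed
  also have "\<dots> = (B *\<^sub>v w) \<bullet> (source_form V (\<lambda>j. transpose_mat (N j) * Z j * N j) i *\<^sub>v (B *\<^sub>v v))"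
    by (rule source_form_bilinear[OF V i W Bwv(2,1), symmetric])
  also have "\<dots> = w \<bullet> ((transpose_mat B * source_form V (\<lambda>j. transpose_mat (N j) * Z j * N j) i * B) *\<^sub>v v)"
    by (rule congruence_form[OF source_form_carrier B v w, symmetric])
  finally show "w \<bullet> (source_form V' Z i *\<^sub>v v) = \<dots>" .
qed (use B in auto)

section \<open>Equivalent tuples that are nearly extremal\<close>

text \<open>
  The denominator is moved to the other side so that the property passes to limits of \<open>V\<close>.
\<close>

definition capacity_at_least :: "real \<Rightarrow> ('a \<Rightarrow> real mat) \<Rightarrow> bool" where
  "capacity_at_least c V \<longleftrightarrow> (\<forall>Z. (\<forall>j\<in>{1..m}. Z j \<in> PD (n j)) \<longrightarrow>
     c * (\<Prod>j\<in>{1..m}. det (Z j) powr p j) \<le> (\<Prod>i\<in>{1..k}. det (source_form V Z i)))"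

text \<open>
  At a point \<open>Y\<close> whose value is below \<open>1 / c\<close> times the capacity, the change of bases that moves
  \<open>Y\<close> and all \<open>F\<^sub>i(V, Y)\<close> to the identity divides the capacity functional by its value at \<open>Y\<close>,
  and so raises the infimum above \<open>c\<close>.
\<close>

lemma nearly_extremal_equivalent:
  assumes feasible: "feasible_datum k m d n A V p" and c: "0 < c" "c < 1"
  shows "\<exists>V'. equivalent_tuples k m d n A V V' \<and> isometric V' \<and> capacity_at_least c V'"
proof -
  have V: "V \<in> tuples" using feasible by (auto simp: feasible_datum_def quiver_datum_def)
  define f where "f Y = (\<Prod>i\<in>{1..k}. det (source_form V Y i)) / (\<Prod>j\<in>{1..m}. det (Y j) powr p j)" for Y
  define \<Y> where "\<Y> = {Y. \<forall>j\<in>{1..m}. Y j \<in> PD (n j)}"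
  define C where "C = capacity k m d n A V p"
  have C: "C = (INF Y\<in>\<Y>. f Y)" "C > 0"
    using feasible by (auto simp: C_def capacity_def feasible_datum_def f_def \<Y>_def source_form_def)
  have denom: "(\<Prod>j\<in>{1..m}. det (Y j) powr p j) > 0" if "Y \<in> \<Y>" for Y
    using that PD_det_pos by (intro prod_pos) (force simp: \<Y>_def)
  have "f Y \<ge> 0" if "Y \<in> \<Y>" for Y
    unfolding f_def using that denom[OF that] source_form_det_nonneg[OF V]
    by (intro divide_nonneg_pos prod_nonneg) (auto simp: \<Y>_def)
  then have bdd: "bdd_below (f ` \<Y>)" by (auto intro: bdd_belowI[of _ 0])
  have lower: "C \<le> f Y" if "Y \<in> \<Y>" for Y
    unfolding C(1) by (rule cINF_lower[OF bdd that])
  have "\<Y> \<noteq> {}" using PD_one by (auto simp: \<Y>_def intro: exI[of _ "\<lambda>j. 1\<^sub>m (n j)"])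
  moreover have "(INF Y\<in>\<Y>. f Y) < C / c" using C c by (simp add: field_simps)
  ultimately obtain Y where Y: "Y \<in> \<Y>" "f Y < C / c"
    using cINF_less_iff[OF _ bdd] by blast
  have YPD: "Y j \<in> PD (n j)" if "j \<in> {1..m}" for j using Y that by (auto simp: \<Y>_def)
  \<comment> \<open>The functional is nonzero at \<open>Y\<close> because the capacity is positive, so the forms are invertible.\<close>
  have "f Y \<noteq> 0" using lower[OF Y(1)] C(2) by simp
  then have "det (source_form V Y i) \<noteq> 0" if "i \<in> {1..k}" for i
    using that by (auto simp: f_def)
  then have FPD: "source_form V Y i \<in> PD (d i)" if "i \<in> {1..k}" for i
    using source_form_PD[OF V that YPD] that by blast
  have "\<exists>N. N \<in> carrier_mat (n j) (n j) \<and> det N > 0 \<and> transpose_mat N * N = Y j" if "j \<in> {1..m}" for j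
    using PD_factor[OF YPD[OF that]] by blast
  then obtain N where N: "\<And>j. j \<in> {1..m} \<Longrightarrow>
      N j \<in> carrier_mat (n j) (n j) \<and> det (N j) > 0 \<and> transpose_mat (N j) * N j = Y j"
    by metis
  have "\<exists>M. M \<in> carrier_mat (d i) (d i) \<and> det M > 0 \<and> transpose_mat M * M = source_form V Y i"
    if "i \<in> {1..k}" for i
    using PD_factor[OF FPD[OF that]] by blast
  then obtain M where M: "\<And>i. i \<in> {1..k} \<Longrightarrow>
      M i \<in> carrier_mat (d i) (d i) \<and> det (M i) > 0 \<and> transpose_mat (M i) * M i = source_form V Y i"
    by metis
  define B where "B i = the (mat_inverse (M i))" for i
  have B: "B i \<in> carrier_mat (d i) (d i)" "M i * B i = 1\<^sub>m (d i)" "invertible_mat (M i)" if "i \<in> {1..k}" for i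
    using det_nonzero_mat_inverse[of "M i" "d i"] M[OF that] by (auto simp: B_def)
  obtain src tgt where ends: "\<And>i j a. i \<in> {1..k} \<Longrightarrow> j \<in> {1..m} \<Longrightarrow> a \<in> A i j \<Longrightarrow> src a = i \<and> tgt a = j"
    using arrow_ends by blast
  define V' where "V' = (\<lambda>a\<in>arrows k m A. N (tgt a) * V a * B (src a))"
  have V'a: "V' a = N j * V a * B i" if "i \<in> {1..k}" "j \<in> {1..m}" "a \<in> A i j" for i j a
    using ends[OF that] that by (auto simp: V'_def arrows_def)
  have V': "V' \<in> tuples"
    unfolding matrix_tuples_def
  proof (intro CollectI conjI ballI)
    show "V' \<in> extensional (arrows k m A)" by (simp add: V'_def)
    fix i j a assume ija: "i \<in> {1..k}" "j \<in> {1..m}" "a \<in> A i j"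
    show "V' a \<in> carrier_mat (n j) (d i)"
      unfolding V'a[OF ija] using N[OF ija(2)] B(1)[OF ija(1)] tuple_carrier[OF V ija] by auto
  qed
  have "equivalent_tuples k m d n A V V'"
    unfolding equivalent_tuples_def
  proof (intro conjI V V', rule exI[of _ M], rule exI[of _ N], intro conjI ballI)
    show "M i \<in> carrier_mat (d i) (d i)" "invertible_mat (M i)" if "i \<in> {1..k}" for i
      using M[OF that] B(3)[OF that] by auto
    show "N j \<in> carrier_mat (n j) (n j)" "invertible_mat (N j)" if "j \<in> {1..m}" for j
      using N[OF that] det_nonzero_mat_inverse(1)[of "N j" "n j"] by auto
    show "V' a = N j * V a * the (mat_inverse (M i))" if "i \<in> {1..k}" "j \<in> {1..m}" "a \<in> A i j" for i j a
      using V'a[OF that] by (simp add: B_def)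
  qed
  moreover have scaled: "source_form V' Z i =
      transpose_mat (B i) * source_form V (\<lambda>j. transpose_mat (N j) * Z j * N j) i * B i"
    if "i \<in> {1..k}" "\<And>j. j \<in> {1..m} \<Longrightarrow> Z j \<in> carrier_mat (n j) (n j)" for Z i
    by (rule source_form_congruence[OF V that(1) that(2) _ B(1)[OF that(1)] V'])
      (use N V'a[OF that(1)] in auto)
  have normalised: "transpose_mat (B i) * source_form V Y i * B i = 1\<^sub>m (d i)" if i: "i \<in> {1..k}" for i
  proof -
    have Mi: "M i \<in> carrier_mat (d i) (d i)" "transpose_mat (M i) * M i = source_form V Y i"
      using M[OF i] by auto
    have "transpose_mat (B i) * (transpose_mat (M i) * M i) * B i = transpose_mat (M i * B i) * (M i * B i)"
      using Mi(1) B(1)[OF i] transpose_mult[of "M i" "d i" "d i" "B i" "d i"]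
      by (simp add: assoc_mult_mat[of _ "d i" "d i" _ "d i" _ "d i"])
    then have "transpose_mat (B i) * source_form V Y i * B i = transpose_mat (M i * B i) * (M i * B i)"
      by (simp only: Mi(2))
    then show ?thesis using B[OF i] by simp
  qed
  moreover have "isometric V'"
    unfolding isometric_def
  proof
    fix i assume i: "i \<in> {1..k}"
    have "source_form V (\<lambda>j. transpose_mat (N j) * 1\<^sub>m (n j) * N j) i = source_form V Y i"
      using N by (intro source_form_cong) (metis mult.right_neutral right_mult_one_mat transpose_carrier_mat)
    then show "source_form V' (\<lambda>j. 1\<^sub>m (n j)) i = 1\<^sub>m (d i)"
      using scaled[OF i, of "\<lambda>j. 1\<^sub>m (n j)"] normalised[OF i] by simp
  qed
  moreover have "capacity_at_least c V'"
    unfolding capacity_at_least_def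
  proof (intro allI impI)
    fix Z assume Z: "\<forall>j\<in>{1..m}. Z j \<in> PD (n j)"
    define W where "W = (\<lambda>j. transpose_mat (N j) * Z j * N j)"
    have Zc: "Z j \<in> carrier_mat (n j) (n j)" if "j \<in> {1..m}" for j using Z that by (auto simp: PD_def)
    have W: "W \<in> \<Y>"
      unfolding \<Y>_def W_def
    proof (intro CollectI ballI)
      fix j assume "j \<in> {1..m}"
      then show "transpose_mat (N j) * Z j * N j \<in> PD (n j)"
        using PD_congruence[of "Z j" "n j" "N j"] N[of j] Z by auto
    qed
    define FW FY y z where "FW = (\<Prod>i\<in>{1..k}. det (source_form V W i))"
      and "FY = (\<Prod>i\<in>{1..k}. det (source_form V Y i))"
      and "y = (\<Prod>j\<in>{1..m}. det (Y j) powr p j)"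
      and "z = (\<Prod>j\<in>{1..m}. det (Z j) powr p j)"
    have pos: "FY > 0" "y > 0" "z > 0"
      using denom[OF Y(1)] denom[of Z] Z PD_det_pos[OF FPD]
      unfolding FY_def y_def z_def by (auto simp: \<Y>_def intro!: prod_pos)
    have "det (W j) powr p j = det (Z j) powr p j * det (Y j) powr p j" if "j \<in> {1..m}" for j
    proof -
      have "det (W j) = det (Z j) * det (Y j)"
        using det_congruence[OF Zc[OF that]] det_gram[of "N j" "n j"] N[OF that] by (simp add: W_def)
      then show ?thesis using PD_det_pos[OF YPD[OF that]] PD_det_pos[of "Z j" "n j"] Z that
        by (simp add: powr_mult)
    qed
    then have fW: "f W = FW / (z * y)"
      unfolding f_def FW_def z_def y_def by (simp add: prod.distrib)
    \<comment> \<open>In the new bases \<open>f\<close> is replaced by \<open>f W / f Y\<close>, where \<open>W\<close> corresponds to \<open>Z\<close>.\<close>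
    have "c * f Y < C" using Y(2) c by (simp add: field_simps)
    also have "C \<le> f W" by (rule lower[OF W])
    finally have "c * (FY / y) < FW / (z * y)" unfolding fW by (simp add: f_def FY_def y_def)
    then have "c * z \<le> FW / FY" using pos by (simp add: field_simps)
    also have "FW / FY = (\<Prod>i\<in>{1..k}. det (source_form V' Z i))"
      unfolding FW_def FY_def prod_dividef[symmetric]
    proof (rule prod.cong[OF refl])
      fix i assume i: "i \<in> {1..k}"
      have "det (source_form V' Z i) = det (source_form V W i) * (det (B i))\<^sup>2"
        using scaled[OF i Zc] det_congruence[OF source_form_carrier B(1)[OF i]] by (simp add: W_def)
      moreover have "det (source_form V Y i) * (det (B i))\<^sup>2 = 1"
        using normalised[OF i] det_congruence[OF source_form_carrier B(1)[OF i]] by (metis det_one)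
      ultimately show "det (source_form V W i) / det (source_form V Y i) = det (source_form V' Z i)"
        by (smt (verit) divide_eq_eq mult.assoc mult.commute mult_cancel_right1 mult_zero_left)
    qed
    finally show "c * (\<Prod>j\<in>{1..m}. det (Z j) powr p j) \<le> (\<Prod>i\<in>{1..k}. det (source_form V' Z i))"
      by (simp add: z_def)
  qed
  ultimately show ?thesis by blast
qed

section \<open>Compactness and passage to the limit\<close>

definition entrywise_limit :: "(nat \<Rightarrow> 'a \<Rightarrow> real mat) \<Rightarrow> ('a \<Rightarrow> real mat) \<Rightarrow> bool" where
  "entrywise_limit X G \<longleftrightarrow> (\<forall>i\<in>{1..k}. \<forall>j\<in>{1..m}. \<forall>a\<in>A i j. \<forall>l<n j. \<forall>c<d i.
     (\<lambda>\<nu>. X \<nu> a $$ (l, c)) \<longlonglongrightarrow> G a $$ (l, c))"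

lemma source_form_identity_entry:
  assumes V: "V \<in> tuples" and i: "i \<in> {1..k}" and st: "s < d i" "t < d i"
  shows "source_form V (\<lambda>j. 1\<^sub>m (n j)) i $$ (s, t) =
    (\<Sum>j\<in>{1..m}. p j * (\<Sum>a\<in>A i j. \<Sum>l<n j. V a $$ (l, s) * V a $$ (l, t)))"
  unfolding source_form_entry[OF st]
proof (intro sum.cong refl arg_cong2[of _ _ _ _ "(*)"])
  fix j a assume ja: "j \<in> {1..m}" "a \<in> A i j"
  have "V a \<in> carrier_mat (n j) (d i)" using V i ja by (rule tuple_carrier)
  then show "(transpose_mat (V a) * 1\<^sub>m (n j) * V a) $$ (s, t) = (\<Sum>l<n j. V a $$ (l, s) * V a $$ (l, t))"
    using gram_entry[of "V a" "n j" "d i" s t] st right_mult_one_mat[of "transpose_mat (V a)" "d i" "n j"] by simp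
qed

text \<open>
  The diagonal entry \<open>(c, c)\<close> of the isometry condition expresses \<open>1\<close> as a sum of nonnegative
  terms, among them \<open>p\<^sub>j\<close> times the square of the given entry.
\<close>

lemma isometric_entry_bound:
  assumes V: "V \<in> tuples" "isometric V" and ija: "i \<in> {1..k}" "j \<in> {1..m}" "a \<in> A i j"
    and l: "l < n j" and c: "c < d i"
  shows "\<bar>V a $$ (l, c)\<bar> \<le> sqrt (1 / p j)"
proof -
  have nonneg: "(\<Sum>a\<in>A i j. \<Sum>l<n j. V a $$ (l, c) * V a $$ (l, c)) \<ge> 0" for j
    by (intro sum_nonneg) simp
  have "(V a $$ (l, c))\<^sup>2 \<le> (\<Sum>l<n j. V a $$ (l, c) * V a $$ (l, c))"
    unfolding power2_eq_square using l by (intro member_le_sum[of l "{..<n j}" "\<lambda>l. V a $$ (l, c) * V a $$ (l, c)"]) auto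
  also have "\<dots> \<le> (\<Sum>a\<in>A i j. \<Sum>l<n j. V a $$ (l, c) * V a $$ (l, c))"
    using ija finite_arrows_between
    by (intro member_le_sum[of a "A i j" "\<lambda>a. \<Sum>l<n j. V a $$ (l, c) * V a $$ (l, c)"] sum_nonneg) auto
  finally have "p j * (V a $$ (l, c))\<^sup>2 \<le> p j * \<dots>"
    using p_pos[OF ija(2)] by simp
  also have "\<dots> \<le> (\<Sum>j\<in>{1..m}. p j * (\<Sum>a\<in>A i j. \<Sum>l<n j. V a $$ (l, c) * V a $$ (l, c)))"
    using ija(2) by (intro member_le_sum[of j "{1..m}" "\<lambda>j. p j * (\<Sum>a\<in>A i j. \<Sum>l<n j. V a $$ (l, c) * V a $$ (l, c))"])
      (auto intro!: mult_nonneg_nonneg nonneg less_imp_le[OF p_pos])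
  also have "\<dots> = source_form V (\<lambda>j. 1\<^sub>m (n j)) i $$ (c, c)"
    by (rule source_form_identity_entry[OF V(1) ija(1) c c, symmetric])
  also have "\<dots> = 1" using V(2) ija(1) c by (simp add: isometric_def)
  finally have "(V a $$ (l, c))\<^sup>2 \<le> 1 / p j" using p_pos[OF ija(2)] by (simp add: field_simps)
  then have "sqrt ((V a $$ (l, c))\<^sup>2) \<le> sqrt (1 / p j)" by (rule real_sqrt_le_mono)
  then show ?thesis by simp
qed

lemma source_form_limit:
  assumes X: "\<And>\<nu>. X \<nu> \<in> tuples" and G: "G \<in> tuples" and lim: "entrywise_limit X G"
    and i: "i \<in> {1..k}" and Z: "\<And>j. j \<in> {1..m} \<Longrightarrow> Z j \<in> carrier_mat (n j) (n j)"
    and st: "s < d i" "t < d i"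
  shows "(\<lambda>\<nu>. source_form (X \<nu>) Z i $$ (s, t)) \<longlonglongrightarrow> source_form G Z i $$ (s, t)"
  unfolding source_form_entry[OF st]
proof (intro tendsto_sum tendsto_mult_left)
  fix j a assume ja: "j \<in> {1..m}" "a \<in> A i j"
  have entry: "(\<lambda>\<nu>. X \<nu> a $$ (l, c)) \<longlonglongrightarrow> G a $$ (l, c)" if "l < n j" "c < d i" for l c
    using lim i ja that by (auto simp: entrywise_limit_def)
  show "(\<lambda>\<nu>. (transpose_mat (X \<nu> a) * Z j * X \<nu> a) $$ (s, t)) \<longlonglongrightarrow> (transpose_mat (G a) * Z j * G a) $$ (s, t)"
    unfolding congruence_entry[OF Z[OF ja(1)] tuple_carrier[OF X i ja] st]
      congruence_entry[OF Z[OF ja(1)] tuple_carrier[OF G i ja] st]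
    using st by (intro tendsto_intros entry) auto
qed

lemma isometric_limit:
  assumes X: "\<And>\<nu>. X \<nu> \<in> tuples" "\<And>\<nu>. isometric (X \<nu>)" and G: "G \<in> tuples" and lim: "entrywise_limit X G"
  shows "isometric G"
  unfolding isometric_def
proof (intro ballI eq_matI)
  fix i s t assume i: "i \<in> {1..k}" and "s < dim_row (1\<^sub>m (d i))" "t < dim_col (1\<^sub>m (d i))"
  then have st: "s < d i" "t < d i" by auto
  have "(\<lambda>\<nu>. source_form (X \<nu>) (\<lambda>j. 1\<^sub>m (n j)) i $$ (s, t)) \<longlonglongrightarrow> source_form G (\<lambda>j. 1\<^sub>m (n j)) i $$ (s, t)"
    using source_form_limit[OF X(1) G lim i _ st] by simp
  moreover have "source_form (X \<nu>) (\<lambda>j. 1\<^sub>m (n j)) i = 1\<^sub>m (d i)" for \<nu>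
    using X(2) i by (auto simp: isometric_def)
  ultimately show "source_form G (\<lambda>j. 1\<^sub>m (n j)) i $$ (s, t) = 1\<^sub>m (d i) $$ (s, t)"
    by (simp add: LIMSEQ_const_iff)
qed (use carrier_matD[OF source_form_carrier] in auto)

lemma capacity_at_least_limit:
  assumes X: "\<And>\<nu>. X \<nu> \<in> tuples" "\<And>\<nu>. capacity_at_least (c \<nu>) (X \<nu>)" and c: "c \<longlonglongrightarrow> c'"
    and G: "G \<in> tuples" and lim: "entrywise_limit X G"
  shows "capacity_at_least c' G"
  unfolding capacity_at_least_def
proof (intro allI impI)
  fix Z assume Z: "\<forall>j\<in>{1..m}. Z j \<in> PD (n j)"
  then have Zc: "Z j \<in> carrier_mat (n j) (n j)" if "j \<in> {1..m}" for j using that by (auto simp: PD_def)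
  show "c' * (\<Prod>j\<in>{1..m}. det (Z j) powr p j) \<le> (\<Prod>i\<in>{1..k}. det (source_form G Z i))"
  proof (rule LIMSEQ_le)
    show "(\<lambda>\<nu>. c \<nu> * (\<Prod>j\<in>{1..m}. det (Z j) powr p j)) \<longlonglongrightarrow> c' * (\<Prod>j\<in>{1..m}. det (Z j) powr p j)"
      by (intro tendsto_intros c)
    show "(\<lambda>\<nu>. \<Prod>i\<in>{1..k}. det (source_form (X \<nu>) Z i)) \<longlonglongrightarrow> (\<Prod>i\<in>{1..k}. det (source_form G Z i))"
      by (intro tendsto_prod tendsto_det[OF source_form_carrier source_form_carrier]
          source_form_limit[OF X(1) G lim _ Zc])
    show "\<exists>N. \<forall>\<nu>\<ge>N. c \<nu> * (\<Prod>j\<in>{1..m}. det (Z j) powr p j) \<le> (\<Prod>i\<in>{1..k}. det (source_form (X \<nu>) Z i))"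
      using X(2) Z by (auto simp: capacity_at_least_def)
  qed
qed

text \<open>
  Since the arrow sets are disjoint, the shape of the matrix at an arrow depends on the arrow alone,
  which allows entries to be indexed by a single finite set of triples.
\<close>

lemma tuple_shape:
  obtains R C :: "'a \<Rightarrow> nat"
  where "\<And>W. W \<in> tuples \<longleftrightarrow> W \<in> extensional (arrows k m A) \<and> (\<forall>a\<in>arrows k m A. W a \<in> carrier_mat (R a) (C a))"
    and "\<And>i j a. i \<in> {1..k} \<Longrightarrow> j \<in> {1..m} \<Longrightarrow> a \<in> A i j \<Longrightarrow> R a = n j \<and> C a = d i"
proof -
  obtain src tgt where ends: "\<And>i j a. i \<in> {1..k} \<Longrightarrow> j \<in> {1..m} \<Longrightarrow> a \<in> A i j \<Longrightarrow> src a = i \<and> tgt a = j"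
    using arrow_ends by blast
  show thesis
  proof (rule that[of "\<lambda>a. n (tgt a)" "\<lambda>a. d (src a)"])
    show "W \<in> tuples \<longleftrightarrow> W \<in> extensional (arrows k m A) \<and>
        (\<forall>a\<in>arrows k m A. W a \<in> carrier_mat (n (tgt a)) (d (src a)))" for W
    proof -
      have "(\<forall>i\<in>{1..k}. \<forall>j\<in>{1..m}. \<forall>a\<in>A i j. W a \<in> carrier_mat (n j) (d i)) \<longleftrightarrow>
          (\<forall>i\<in>{1..k}. \<forall>j\<in>{1..m}. \<forall>a\<in>A i j. W a \<in> carrier_mat (n (tgt a)) (d (src a)))"
        by (intro ball_cong refl) (simp only: ends)
      then show ?thesis by (auto simp: matrix_tuples_def arrows_def)
    qed
    show "n (tgt a) = n j \<and> d (src a) = d i" if "i \<in> {1..k}" "j \<in> {1..m}" "a \<in> A i j" for i j a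
      using ends[OF that] by simp
  qed
qed

lemma finite_arrows: "finite (arrows k m A)"
  unfolding arrows_def using finite_arrows_between by auto

lemma isometric_convergent_subsequence:
  fixes X :: "nat \<Rightarrow> 'a \<Rightarrow> real mat"
  assumes X: "\<And>\<nu>. X \<nu> \<in> tuples" "\<And>\<nu>. isometric (X \<nu>)"
  shows "\<exists>\<sigma> G. strict_mono \<sigma> \<and> G \<in> tuples \<and> entrywise_limit (X \<circ> \<sigma>) G"
proof -
  obtain R C where tuples_iff: "\<And>W. W \<in> tuples \<longleftrightarrow> W \<in> extensional (arrows k m A) \<and>
        (\<forall>a\<in>arrows k m A. W a \<in> carrier_mat (R a) (C a))"
    and dims: "\<And>i j a. i \<in> {1..k} \<Longrightarrow> j \<in> {1..m} \<Longrightarrow> a \<in> A i j \<Longrightarrow> R a = n j \<and> C a = d i"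
    using tuple_shape by blast
  define I where "I = (SIGMA a:arrows k m A. {..<R a} \<times> {..<C a})"
  have "Bseq (\<lambda>\<nu>. (\<lambda>(a, l, c). X \<nu> a $$ (l, c)) x)" if x: "x \<in> I" for x
  proof -
    obtain i j a l c where ija: "i \<in> {1..k}" "j \<in> {1..m}" "a \<in> A i j" and lc: "l < n j" "c < d i"
      and xalc: "x = (a, l, c)"
      using x dims unfolding I_def arrows_def by fastforce
    have "\<bar>X \<nu> a $$ (l, c)\<bar> \<le> sqrt (1 / p j)" for \<nu>
      by (rule isometric_entry_bound[OF X ija lc])
    then show ?thesis unfolding xalc by (intro BseqI'[of _ "sqrt (1 / p j)"]) auto
  qed
  moreover have "finite I" unfolding I_def using finite_arrows by auto
  ultimately obtain \<sigma> L where \<sigma>: "strict_mono \<sigma>"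
    and L: "\<forall>x\<in>I. (\<lambda>\<nu>. (\<lambda>(a, l, c). X (\<sigma> \<nu>) a $$ (l, c)) x) \<longlonglongrightarrow> L x"
    using convergent_subsequence_finite[of I "\<lambda>\<nu> (a, l, c). X \<nu> a $$ (l, c)"] by blast
  define G where "G = (\<lambda>a\<in>arrows k m A. mat (R a) (C a) (\<lambda>(l, c). L (a, l, c)))"
  have "G \<in> tuples" unfolding tuples_iff by (simp add: G_def)
  moreover have "entrywise_limit (X \<circ> \<sigma>) G"
    unfolding entrywise_limit_def
  proof (intro ballI allI impI)
    fix i j a l c assume ija: "i \<in> {1..k}" "j \<in> {1..m}" "a \<in> A i j" and lc: "l < n j" "c < d i"
    have a: "a \<in> arrows k m A" using ija unfolding arrows_def by blast
    with lc dims[OF ija] have "(a, l, c) \<in> I" by (simp add: I_def)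
    with L show "(\<lambda>\<nu>. (X \<circ> \<sigma>) \<nu> a $$ (l, c)) \<longlonglongrightarrow> G a $$ (l, c)"
      using a lc dims[OF ija] by (auto simp: G_def)
  qed
  ultimately show ?thesis using \<sigma> by blast
qed

text \<open>
  Expanding a tuple in the basis of tuples with a single nonzero entry, the triangle inequality
  bounds any norm by a weighted sum of the absolute values of the entries.
\<close>

lemma tuple_norm_limit:
  assumes norm: "tuple_norm k m d n A norm'"
    and X: "\<And>\<nu>. X \<nu> \<in> tuples" and G: "G \<in> tuples" and lim: "entrywise_limit X G"
  shows "(\<lambda>\<nu>. norm' (tuple_diff (arrows k m A) G (X \<nu>))) \<longlonglongrightarrow> 0"
proof -
  obtain R C where tuples_iff: "\<And>W. W \<in> tuples \<longleftrightarrow> W \<in> extensional (arrows k m A) \<and>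
        (\<forall>a\<in>arrows k m A. W a \<in> carrier_mat (R a) (C a))"
    and dims: "\<And>i j a. i \<in> {1..k} \<Longrightarrow> j \<in> {1..m} \<Longrightarrow> a \<in> A i j \<Longrightarrow> R a = n j \<and> C a = d i"
    using tuple_shape by blast
  let ?S = "arrows k m A"
  define I where "I = (SIGMA a:?S. {..<R a} \<times> {..<C a})"
  have fin: "finite I" unfolding I_def using finite_arrows by auto
  \<comment> \<open>The triangle inequality is applied one entry at a time, along the subsets \<open>T\<close> of the set of all positions.\<close>
  define restr where "restr T W = (\<lambda>a\<in>?S. mat (R a) (C a)
      (\<lambda>(l, c). if (a, l, c) \<in> T then W a $$ (l, c) else 0))" for T and W :: "'a \<Rightarrow> real mat"
  define basis where "basis x = restr {x} (\<lambda>a. mat (R a) (C a) (\<lambda>_. 1))" for x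
  define entry where "entry W = (\<lambda>(a, l, c). W a $$ (l, c))" for W :: "'a \<Rightarrow> real mat"
  have restr_tuple: "restr T W \<in> tuples" for T W unfolding tuples_iff by (simp add: restr_def)
  have basis_tuple: "basis x \<in> tuples" for x unfolding basis_def by (rule restr_tuple)
  have smult_tuple: "tuple_smult ?S r W \<in> tuples" if "W \<in> tuples" for r W
    using that unfolding tuples_iff by (simp add: tuple_smult_def)
  have bound: "norm' (restr T W) \<le> (\<Sum>x\<in>T. \<bar>entry W x\<bar> * norm' (basis x))"
    if "finite T" "T \<subseteq> I" for T W
    using that
  proof (induction T)
    case empty
    have "restr {} W a = 0\<^sub>m (n j) (d i)" if "i \<in> {1..k}" "j \<in> {1..m}" "a \<in> A i j" for i j a
      using dims[OF that] that by (intro eq_matI) (auto simp: restr_def arrows_def)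
    then have "norm' (restr {} W) = 0"
      using norm restr_tuple[of "{}" W] by (auto simp: tuple_norm_def)
    then show ?case by simp
  next
    case (insert x T)
    obtain a l c where x: "x = (a, l, c)" by (cases x)
    have "restr (insert x T) W = tuple_add ?S (restr T W) (tuple_smult ?S (entry W x) (basis x))"
    proof
      fix b show "restr (insert x T) W b = tuple_add ?S (restr T W) (tuple_smult ?S (entry W x) (basis x)) b"
      proof (cases "b \<in> ?S")
        case True
        then show ?thesis using insert.hyps(2) x
          by (intro eq_matI) (auto simp: restr_def basis_def tuple_add_def tuple_smult_def entry_def)
      qed (simp add: restr_def tuple_add_def)
    qed
    then have "norm' (restr (insert x T) W) \<le> norm' (restr T W) + norm' (tuple_smult ?S (entry W x) (basis x))"
      using norm restr_tuple[of T W] smult_tuple[OF basis_tuple] by (auto simp: tuple_norm_def)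
    also have "norm' (tuple_smult ?S (entry W x) (basis x)) = \<bar>entry W x\<bar> * norm' (basis x)"
      using norm basis_tuple by (auto simp: tuple_norm_def)
    finally show ?case using insert by simp
  qed
  have restr_id: "restr I W = W" if "W \<in> tuples" for W
  proof
    fix b show "restr I W b = W b"
    proof (cases "b \<in> ?S")
      case True
      then have "W b \<in> carrier_mat (R b) (C b)" using that tuples_iff by blast
      then show ?thesis using True by (intro eq_matI) (auto simp: restr_def I_def)
    next
      case False
      then show ?thesis using that tuples_iff by (auto simp: restr_def extensional_def)
    qed
  qed
  have diff_tuple: "tuple_diff ?S G (X \<nu>) \<in> tuples" for \<nu>
    using G X[of \<nu>] unfolding tuples_iff by (auto simp: tuple_diff_def intro: minus_carrier_mat)
  let ?b = "\<lambda>\<nu>. \<Sum>x\<in>I. \<bar>entry (tuple_diff ?S G (X \<nu>)) x\<bar> * norm' (basis x)"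
  have "?b \<longlonglongrightarrow> (\<Sum>x\<in>I. \<bar>0\<bar> * norm' (basis x))"
  proof (intro tendsto_intros)
    fix x assume "x \<in> I"
    then obtain a i j l c where ija: "i \<in> {1..k}" "j \<in> {1..m}" "a \<in> A i j" and lc: "l < n j" "c < d i"
      and x: "x = (a, l, c)"
      using dims unfolding I_def arrows_def by fastforce
    have a: "a \<in> ?S" using ija unfolding arrows_def by blast
    have "entry (tuple_diff ?S G (X \<nu>)) x = G a $$ (l, c) - X \<nu> a $$ (l, c)" for \<nu>
      using a lc carrier_matD[OF tuple_carrier[OF G ija]] carrier_matD[OF tuple_carrier[OF X[of \<nu>] ija]]
      by (simp add: entry_def x tuple_diff_def)
    moreover have "(\<lambda>\<nu>. G a $$ (l, c) - X \<nu> a $$ (l, c)) \<longlonglongrightarrow> G a $$ (l, c) - G a $$ (l, c)"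
      using lim ija lc by (intro tendsto_intros) (auto simp: entrywise_limit_def)
    ultimately show "(\<lambda>\<nu>. entry (tuple_diff ?S G (X \<nu>)) x) \<longlonglongrightarrow> 0" by simp
  qed
  then have lim_b: "?b \<longlonglongrightarrow> 0" by simp
  have upper: "norm' (tuple_diff ?S G (X \<nu>)) \<le> ?b \<nu>" for \<nu>
    using bound[OF fin order_refl, of "tuple_diff ?S G (X \<nu>)"] restr_id[OF diff_tuple] by simp
  have lower: "0 \<le> norm' (tuple_diff ?S G (X \<nu>))" for \<nu>
    using norm diff_tuple by (simp add: tuple_norm_def)
  show ?thesis
    by (rule tendsto_sandwich[OF always_eventually[OF allI[OF lower]] always_eventually[OF allI[OF upper]]
        tendsto_const lim_b])
qed

section \<open>The first-order condition at the identity\<close>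

text \<open>
  The identity minimises the capacity functional of \<open>G\<close>. Varying only the matrix at the target
  \<open>j0\<close> to \<open>N\<^sup>T N\<close> for an elementary matrix \<open>N\<close> keeps all determinants explicit, so no derivative
  of a determinant is computed: on the side of the targets the determinant is exactly
  \<open>(1 + \<delta> t)\<^sup>2\<close>, and on the side of the sources the trace bound is sharp to first order.
\<close>

lemma extremal_first_order_condition:
  assumes G: "G \<in> tuples" "isometric G" "capacity_at_least 1 G"
    and j0: "j0 \<in> {1..m}" and s: "s < n j0" and u: "u < n j0"
  shows "(\<Sum>i\<in>{1..k}. \<Sum>a\<in>A i j0. (G a * transpose_mat (G a)) $$ (s, u)) = (if s = u then 1 else 0)"
proof (rule coefficient_from_exp_bound)
  define Q where "Q x y = (\<Sum>i\<in>{1..k}. \<Sum>a\<in>A i j0. (G a * transpose_mat (G a)) $$ (x, y))" for x y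
  define \<delta> :: real where "\<delta> = (if s = u then 1 else 0)"
  fix t :: real assume t: "\<bar>t\<bar> < 1"
  define N where "N = addrow_mat (n j0) t s u"
  \<comment> \<open>The factor \<open>1\<^sub>m\<close> exhibits \<open>N\<^sup>T N\<close> as a congruence transform of the identity.\<close>
  define Z where "Z = (\<lambda>j. if j = j0 then transpose_mat N * 1\<^sub>m (n j0) * N else 1\<^sub>m (n j))"
  have N: "N \<in> carrier_mat (n j0) (n j0)" by (simp add: N_def addrow_mat_def)
  have detN: "det N = 1 + \<delta> * t"
    unfolding N_def \<delta>_def using det_addrow_mat_general[OF s u, of t] by simp
  have detN_pos: "det N > 0" using t detN by (auto simp: \<delta>_def)
  have Z: "Z j \<in> PD (n j)" if "j \<in> {1..m}" for j
    using PD_congruence[OF PD_one N] detN_pos PD_one by (auto simp: Z_def)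
  let ?tr = "\<lambda>i. \<Sum>c<d i. source_form G Z i $$ (c, c)"
  \<comment> \<open>The isometry condition says that the unperturbed traces are exactly the dimensions.\<close>
  have tr: "?tr i - real (d i) =
      p j0 * (\<Sum>a\<in>A i j0. 2 * t * (G a * transpose_mat (G a)) $$ (s, u) + t\<^sup>2 * (G a * transpose_mat (G a)) $$ (u, u))"
    if i: "i \<in> {1..k}" for i
  proof -
    let ?h = "\<lambda>U j. \<Sum>a\<in>A i j. \<Sum>c<d i. (transpose_mat (G a) * U j * G a) $$ (c, c)"
    have swap: "(\<Sum>c<d i. source_form G U i $$ (c, c)) = (\<Sum>j\<in>{1..m}. p j * ?h U j)" for U
    proof -
      have "(\<Sum>c<d i. source_form G U i $$ (c, c)) =
          (\<Sum>c<d i. \<Sum>j\<in>{1..m}. p j * (\<Sum>a\<in>A i j. (transpose_mat (G a) * U j * G a) $$ (c, c)))"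
        by (intro sum.cong refl source_form_entry) auto
      also have "\<dots> = (\<Sum>j\<in>{1..m}. \<Sum>c<d i. p j * (\<Sum>a\<in>A i j. (transpose_mat (G a) * U j * G a) $$ (c, c)))"
        by (rule sum.swap)
      also have "\<dots> = (\<Sum>j\<in>{1..m}. p j * ?h U j)"
        unfolding sum_distrib_left[symmetric] by (intro sum.cong refl arg_cong2[of _ _ _ _ "(*)"] sum.swap)
      finally show ?thesis .
    qed
    have "real (d i) = (\<Sum>c<d i. source_form G (\<lambda>j. 1\<^sub>m (n j)) i $$ (c, c))"
      using G(2) i by (simp add: isometric_def)
    then have "?tr i - real (d i) = (\<Sum>j\<in>{1..m}. p j * (?h Z j - ?h (\<lambda>j. 1\<^sub>m (n j)) j))"
      unfolding swap by (simp only: right_diff_distrib sum_subtractf)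
    also have "\<dots> = (\<Sum>j\<in>{1..m}. if j = j0 then p j0 * (?h Z j0 - ?h (\<lambda>j. 1\<^sub>m (n j)) j0) else 0)"
      by (intro sum.cong refl) (simp add: Z_def)
    also have "\<dots> = p j0 * (?h Z j0 - ?h (\<lambda>j. 1\<^sub>m (n j)) j0)"
      using j0 by simp
    also have "?h Z j0 = ?h (\<lambda>j. 1\<^sub>m (n j)) j0 +
        (\<Sum>a\<in>A i j0. 2 * t * (G a * transpose_mat (G a)) $$ (s, u) + t\<^sup>2 * (G a * transpose_mat (G a)) $$ (u, u))"
      unfolding sum.distrib[symmetric]
      using trace_addrow_congruence[OF tuple_carrier[OF G(1) i j0] s u, of _ t]
      by (intro sum.cong refl) (simp add: Z_def N_def)
    finally show ?thesis by simp
  qed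
  have det_le: "det (source_form G Z i) \<le> exp (?tr i - real (d i))" if i: "i \<in> {1..k}" for i
  proof (cases "det (source_form G Z i) = 0")
    case False
    then show ?thesis by (intro PD_det_le_exp_trace source_form_PD[OF G(1) i Z])
  qed simp
  have "((1 + \<delta> * t)\<^sup>2) powr p j0 = (\<Prod>j\<in>{1..m}. if j = j0 then (det N)\<^sup>2 powr p j0 else 1)"
    using j0 detN by simp
  also have "\<dots> = (\<Prod>j\<in>{1..m}. det (Z j) powr p j)"
    using det_congruence[of "1\<^sub>m (n j0)" "n j0" N] N by (intro prod.cong refl) (auto simp: Z_def)
  also have "\<dots> \<le> (\<Prod>i\<in>{1..k}. det (source_form G Z i))"
    using G(3) Z by (auto simp: capacity_at_least_def)
  also have "\<dots> \<le> (\<Prod>i\<in>{1..k}. exp (?tr i - real (d i)))"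
    by (intro prod_mono conjI det_le source_form_det_nonneg[OF G(1) _ Z])
  also have "\<dots> = exp (\<Sum>i\<in>{1..k}. ?tr i - real (d i))"
    by (simp add: exp_sum)
  also have "(\<Sum>i\<in>{1..k}. ?tr i - real (d i)) = p j0 * (2 * t * Q s u + t\<^sup>2 * Q u u)"
  proof -
    have "(\<Sum>i\<in>{1..k}. ?tr i - real (d i)) = (\<Sum>i\<in>{1..k}. p j0 * (\<Sum>a\<in>A i j0.
        2 * t * (G a * transpose_mat (G a)) $$ (s, u) + t\<^sup>2 * (G a * transpose_mat (G a)) $$ (u, u)))"
      by (intro sum.cong refl tr)
    also have "\<dots> = p j0 * (2 * t * Q s u + t\<^sup>2 * Q u u)"
      by (simp add: sum.distrib sum_distrib_left[symmetric] Q_def)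
    finally show ?thesis .
  qed
  also have "exp \<dots> = exp (2 * t * Q s u + t\<^sup>2 * Q u u) powr p j0"
    by (simp add: powr_def)
  finally have "(1 + \<delta> * t)\<^sup>2 \<le> exp (2 * t * Q s u + t\<^sup>2 * Q u u)"
    using powr_less_mono2[OF p_pos[OF j0], of "exp (2 * t * Q s u + t\<^sup>2 * Q u u)" "(1 + \<delta> * t)\<^sup>2"]
    by (meson exp_ge_zero not_le)
  then show "(1 + (if s = u then 1 else 0) * t)\<^sup>2 \<le>
      exp (2 * t * (\<Sum>i\<in>{1..k}. \<Sum>a\<in>A i j0. (G a * transpose_mat (G a)) $$ (s, u)) + t\<^sup>2 * Q u u)"
    by (simp add: Q_def \<delta>_def)
qed

lemma isometric_extremal_geometric:
  assumes G: "G \<in> tuples" "isometric G" "capacity_at_least 1 G"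
    and dims: "(\<Sum>i\<in>{1..k}. real (d i)) = (\<Sum>j\<in>{1..m}. p j * real (n j))"
  shows "geometric_datum k m d n A G p"
proof -
  have "msum (d i) (d i) (\<lambda>j. p j \<cdot>\<^sub>m msum (d i) (d i) (\<lambda>a. transpose_mat (G a) * G a) (A i j)) {1..m} = 1\<^sub>m (d i)"
    if i: "i \<in> {1..k}" for i
  proof (rule eq_matI)
    fix s t assume "s < dim_row (1\<^sub>m (d i))" "t < dim_col (1\<^sub>m (d i))"
    then have st: "s < d i" "t < d i" by auto
    have "source_form G (\<lambda>j. 1\<^sub>m (n j)) i $$ (s, t) = 1\<^sub>m (d i) $$ (s, t)"
      using G(2) i by (simp add: isometric_def)
    moreover have "(\<Sum>j\<in>{1..m}. p j * (\<Sum>a\<in>A i j. (transpose_mat (G a) * G a) $$ (s, t))) =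
        (\<Sum>j\<in>{1..m}. p j * (\<Sum>a\<in>A i j. \<Sum>l<n j. G a $$ (l, s) * G a $$ (l, t)))"
      by (intro sum.cong refl arg_cong2[of _ _ _ _ "(*)"] gram_entry[OF tuple_carrier[OF G(1) i] st])
    ultimately show "msum (d i) (d i) (\<lambda>j. p j \<cdot>\<^sub>m msum (d i) (d i) (\<lambda>a. transpose_mat (G a) * G a) (A i j)) {1..m} $$ (s, t)
        = 1\<^sub>m (d i) $$ (s, t)"
      unfolding source_form_identity_entry[OF G(1) i st] using st by (simp add: msum_def)
  qed (auto simp: msum_def)
  moreover have "msum (n j) (n j) (\<lambda>i. msum (n j) (n j) (\<lambda>a. G a * transpose_mat (G a)) (A i j)) {1..k} = 1\<^sub>m (n j)"
    if j: "j \<in> {1..m}" for j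
  proof (rule eq_matI)
    fix s t assume "s < dim_row (1\<^sub>m (n j))" "t < dim_col (1\<^sub>m (n j))"
    then have st: "s < n j" "t < n j" by auto
    then show "msum (n j) (n j) (\<lambda>i. msum (n j) (n j) (\<lambda>a. G a * transpose_mat (G a)) (A i j)) {1..k} $$ (s, t)
        = 1\<^sub>m (n j) $$ (s, t)"
      using extremal_first_order_condition[OF G j st] by (simp add: msum_def)
  qed (auto simp: msum_def)
  ultimately show ?thesis
    using shape p_pos G(1) dims by (simp add: geometric_datum_def quiver_datum_def)
qed

end

section \<open>Existence of a geometric limit\<close>

theorem theorem1p9:
  fixes k m :: nat
    and d n :: "nat \<Rightarrow> nat"
    and A :: "nat \<Rightarrow> nat \<Rightarrow> 'a set"
    and p :: "nat \<Rightarrow> real"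
    and V :: "'a \<Rightarrow> real mat"
    and \<nu> :: "('a \<Rightarrow> real mat) \<Rightarrow> real"
  assumes "\<forall>j\<in>{1..m}. p j > 0"
    and "quiver_datum k m d n A V p"
    and "feasible_datum k m d n A V p"
    and "tuple_norm k m d n A \<nu>"
  shows "\<exists>G\<in>matrix_tuples k m d n A. geometric_datum k m d n A G p \<and>
    (\<forall>\<epsilon>>0. \<exists>V'. equivalent_tuples k m d n A V V' \<and>
      \<nu> (tuple_diff (arrows k m A) G V') < \<epsilon>)"
proof -
  interpret quiver k m d n A p
    using assms by unfold_locales (auto simp: quiver_datum_def)
  \<comment> \<open>Shifting the index by two keeps all bounds strictly between \<open>0\<close> and \<open>1\<close>.\<close>
  define c :: "nat \<Rightarrow> real" where "c r = 1 - 1 / real (r + 2)" for r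
  have c: "0 < c r" "c r < 1" for r by (auto simp: c_def field_simps)
  obtain X where X: "\<And>r. equivalent_tuples k m d n A V (X r)" "\<And>r. isometric (X r)"
      "\<And>r. capacity_at_least (c r) (X r)"
    using nearly_extremal_equivalent[OF assms(3) c] by metis
  have Xt: "X r \<in> tuples" for r using X(1) by (auto simp: equivalent_tuples_def)
  obtain \<sigma> G where \<sigma>: "strict_mono \<sigma>" and G: "G \<in> tuples" and lim: "entrywise_limit (X \<circ> \<sigma>) G"
    using isometric_convergent_subsequence[of X, OF Xt X(2)] by blast
  have "isometric G"
    by (rule isometric_limit[of "X \<circ> \<sigma>", OF _ _ G lim]) (auto simp: Xt X)
  moreover have "capacity_at_least 1 G"
  proof (rule capacity_at_least_limit[of "X \<circ> \<sigma>" "c \<circ> \<sigma>", OF _ _ _ G lim])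
    have "(\<lambda>r. 1 / real (r + 2)) \<longlonglongrightarrow> 0"
      using LIMSEQ_ignore_initial_segment[OF lim_1_over_n, of 2] by simp
    then have "c \<longlonglongrightarrow> 1 - 0" unfolding c_def by (intro tendsto_intros)
    then show "(c \<circ> \<sigma>) \<longlonglongrightarrow> 1" using LIMSEQ_subseq_LIMSEQ[OF _ \<sigma>] by simp
  qed (auto simp: Xt X)
  ultimately have "geometric_datum k m d n A G p"
    using assms(2) by (intro isometric_extremal_geometric G) (auto simp: quiver_datum_def)
  moreover have "\<exists>V'. equivalent_tuples k m d n A V V' \<and> \<nu> (tuple_diff (arrows k m A) G V') < \<epsilon>"
    if "\<epsilon> > 0" for \<epsilon>
  proof -
    have "(\<lambda>r. \<nu> (tuple_diff (arrows k m A) G ((X \<circ> \<sigma>) r))) \<longlonglongrightarrow> 0"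
      by (rule tuple_norm_limit[OF assms(4) _ G lim]) (simp add: Xt)
    then have "\<forall>\<^sub>F r in sequentially. \<nu> (tuple_diff (arrows k m A) G ((X \<circ> \<sigma>) r)) < \<epsilon>"
      using that by (rule order_tendstoD(2))
    then obtain r where "\<nu> (tuple_diff (arrows k m A) G ((X \<circ> \<sigma>) r)) < \<epsilon>"
      using eventually_happens'[OF sequentially_bot] by blast
    then show ?thesis using X(1) by auto
  qed
  ultimately show ?thesis using G by blast
qed

end
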